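(* Let $p\ge3$ be a prime and let $N_{PGpGM}$ be the number of $G_2^{(2)}$-periodic (two-periodic) generalized $p$-adic Gibbs measures for the hard-core model with parameters $\lambda_n\in\mathbb Q_p$, $n\in\mathbb N$ (with $\lambda_n\to0$), on the Cayley tree of order two. Put $\theta=\sum_{n=1}^\infty\lambda_n$, assume $\theta\neq0$ and $\theta\ne4$, and write $\theta=p^{\mathrm{ord}_p\theta}(\theta_0+\theta_1p+\cdots)$ with digits $\theta_j\in\{0,\dots,p-1\}$, $\theta_0\neq0$. Then the following statements hold. $N_{PGpGM}$ equals: - $2$, if $|\theta|_p>1$; - $2$, if $|\theta|_p<1$, $2\mid\mathrm{ord}_p\theta$ and $\left(\frac{-\theta_0}{p}\right)=1$; - $0$, if $|\theta|_p<1$ and ($2\nmid\mathrm{ord}_p\theta$ or $\left(\frac{-\theta_0}{p}\right)=-1$); - $2$, if $|\theta|_p=1$ and $\left(\frac{\theta_0^2-4\theta_0}{p}\right)=1$; - $0$, if $|\theta|_p=1$ and $\left(\frac{\theta_0^2-4\theta_0}{p}\right)=-1$; - $2$, if $|\theta|_p=1$, $2\mid\mathrm{ord}_p(\theta-4)$ and $\left(\frac{|\theta-4|_p(\theta-4)\bmod p}{p}\right)=1$; - $0$, if $|\theta|_p=1$ and ($2\nmid\mathrm{ord}_p(\theta-4)$ or $\left(\frac{|\theta-4|_p(\theta-4)\bmod p}{p}\right)=-1$).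
   Context: Model. The Cayley tree of order $k$ is the infinite tree with vertex set $V$, every vertex having $k+1$ neighbours, with root $x^0$ and graph distance $d$; $S(x)$ is the set of the direct successors of $x$ (neighbours farther from the root). For the $p$-adic hard-core model with countably many spin values, configurations are admissible if the product of spins at neighbouring vertices is $0$. Generalized $p$-adic Gibbs measures are the measures determined by functions $x\mapsto \mathbf z_x=(\mathbf z_{i,x})_i$ with entries in $\mathbb Q_p$ satisfying the compatibility equation $\mathbf z_{i,x}=\lambda_i\prod_{y\in S(x)}\bigl(1+\sum_j\mathbf z_{j,y}\bigr)^{-1}$ for all $x\in V\setminus\{x^0\}$ and all $i$ (series convergent, denominators nonzero). A two-periodic ($G_2^{(2)}$-periodic) measure corresponds to a solution $\mathbf z_x$ depending only on the parity of $d(x,x^0)$ and not constant. After indexing by $\mathbb N$, for $k=2$, $N_{PGpGM}$ is the number of sequences $\mathbf z\in c_0$ with $F(F\mathbf z)=\mathbf z$ and $F\mathbf z\neq\mathbf z$, where $c_0$ is the space of sequences in $\mathbb Q_p$ tending to $0$ and $(F\mathbf z)_n=\lambda_n\left(1+\sum_{m\in\mathbb N}\mathbf z_m\right)^{-2}$ (defined when $\sum_m\mathbf z_m\ne-1$). Notation. $\mathbb Q_p$ is the field of $p$-adic numbers; $|x|_p=p^{-\mathrm{ord}_px}$; $\left(\frac{a}{p}\right)$ is the Legendre symbol, defined for integers $a$ not divisible by $p$: it is $1$ if $a$ is a quadratic residue modulo $p$ and $-1$ otherwise; $|\theta-4|_p(\theta-4)$ denotes the $p$-adic unit $p^{-\mathrm{ord}_p(\theta-4)}(\theta-4)$,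 reduced modulo $p$.
   Formalization: The last two bullets are proved only when p divides θ_0²−4θ_0 (i.e. θ_0≡4 mod p); read literally they contradict the fourth and fifth bullets, e.g. p=5, θ=2 gives both N=2 and N=0. *)

theory Defs
  imports
    "HOL-Analysis.Analysis"
    "HOL-Library.Extended_Nat"
    "HOL-Number_Theory.Number_Theory"
    "Berlekamp_Zassenhaus.Finite_Field"
begin

section \<open>The p-adic absolute value on the rationals\<close>

definition rat_ord :: "nat \<Rightarrow> rat \<Rightarrow> int" where
  "rat_ord p q = int (multiplicity (int p) (fst (quotient_of q)))
               - int (multiplicity (int p) (snd (quotient_of q)))"

definition rat_abs :: "nat \<Rightarrow> rat \<Rightarrow> real" where
  "rat_abs p q = (if q = 0 then 0 else real p powi (- rat_ord p q))"

lemma rat_ord_Fract: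
  assumes p: "prime p" and "a \<noteq> 0" "b \<noteq> 0"
  shows "rat_ord p (Rat.Fract a b) = int (multiplicity (int p) a) - int (multiplicity (int p) b)"
proof -
  obtain c d where cd: "quotient_of (Rat.Fract a b) = (c, d)" by fastforce
  have d: "d > 0" using quotient_of_denom_pos[OF cd] .
  have eq: "Rat.Fract a b = Rat.Fract c d"
    using quotient_of_div[OF cd] by (simp add: Fract_of_int_quotient)
  have e: "a * d = c * b" using eq d assms by (simp add: eq_rat)
  have c: "c \<noteq> 0" using e d assms by auto
  have pp: "prime_elem (int p)" using p by auto
  have "multiplicity (int p) (a * d) = multiplicity (int p) a + multiplicity (int p) d"
    using prime_elem_multiplicity_mult_distrib[OF pp] d assms by auto
  moreover have "multiplicity (int p) (c * b) = multiplicity (int p) c + multiplicity (int p) b"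
    using prime_elem_multiplicity_mult_distrib[OF pp] c assms by auto
  ultimately show ?thesis using e cd by (simp add: rat_ord_def)
qed

lemma rat_ord_mult:
  assumes p: "prime p" and "x \<noteq> 0" "y \<noteq> 0"
  shows "rat_ord p (x * y) = rat_ord p x + rat_ord p y"
proof -
  obtain a b where x: "x = Rat.Fract a b" "b > 0" by (cases x) auto
  obtain c d where y: "y = Rat.Fract c d" "d > 0" by (cases y) auto
  have nz: "a \<noteq> 0" "c \<noteq> 0" "b \<noteq> 0" "d \<noteq> 0" using x y assms by (auto simp: rat_number_collapse)
  have pp: "prime_elem (int p)" using p by auto
  show ?thesis
    using nz by (simp add: x y rat_ord_Fract[OF p] prime_elem_multiplicity_mult_distrib[OF pp])
qed

lemma rat_ord_add:
  assumes p: "prime p" and "x \<noteq> 0" "y \<noteq> 0" "x + y \<noteq> 0"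
  shows "min (rat_ord p x) (rat_ord p y) \<le> rat_ord p (x + y)"
proof -
  obtain a b where x: "x = Rat.Fract a b" "b > 0" by (cases x) auto
  obtain c d where y: "y = Rat.Fract c d" "d > 0" by (cases y) auto
  have nz: "a \<noteq> 0" "c \<noteq> 0" "b \<noteq> 0" "d \<noteq> 0" using x y assms by (auto simp: rat_number_collapse)
  have pp: "prime_elem (int p)" using p by auto
  have s: "x + y = Rat.Fract (a * d + c * b) (b * d)" using x y by simp
  have snz: "a * d + c * b \<noteq> 0" using assms(4) s by (auto simp: rat_number_collapse)
  define m where "m = min (multiplicity (int p) (a * d)) (multiplicity (int p) (c * b))"
  have "int p ^ m dvd a * d" "int p ^ m dvd c * b"
    by (auto simp: m_def intro!: multiplicity_dvd')
  hence "int p ^ m dvd a * d + c * b" by auto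
  moreover have "\<not> is_unit (int p)" using pp by auto
  ultimately have "m \<le> multiplicity (int p) (a * d + c * b)"
    using snz by (auto intro: multiplicity_geI)
  moreover have "rat_ord p (x + y) = int (multiplicity (int p) (a * d + c * b))
      - int (multiplicity (int p) b) - int (multiplicity (int p) d)"
    using s snz nz by (simp add: rat_ord_Fract[OF p] prime_elem_multiplicity_mult_distrib[OF pp])
  ultimately show ?thesis
    using nz by (simp add: x y rat_ord_Fract[OF p] m_def prime_elem_multiplicity_mult_distrib[OF pp])
qed

lemma rat_abs_0 [simp]: "rat_abs p 0 = 0"
  by (simp add: rat_abs_def)

lemma rat_abs_nonneg [simp]: "rat_abs p x \<ge> 0"
  by (simp add: rat_abs_def)

lemma rat_abs_eq_0_iff: "prime p \<Longrightarrow> rat_abs p x = 0 \<longleftrightarrow> x = 0"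
  by (auto simp: rat_abs_def dest: prime_gt_0_nat)

lemma rat_abs_mult: "prime p \<Longrightarrow> rat_abs p (x * y) = rat_abs p x * rat_abs p y"
  by (auto simp: rat_abs_def rat_ord_mult power_int_add[symmetric] add.commute dest: prime_gt_0_nat)

lemma rat_abs_1 [simp]: "rat_abs p 1 = 1"
  by (simp add: rat_abs_def rat_ord_def)

lemma rat_abs_minus: assumes p: "prime p" shows "rat_abs p (- x) = rat_abs p x"
proof -
  have "rat_abs p (-1) ^ 2 = 1"
    using rat_abs_mult[OF p, of "-1" "-1"] by (simp add: power2_eq_square)
  hence "rat_abs p (-1) = 1" using rat_abs_nonneg[of p "-1"] by (simp add: power2_eq_1_iff)
  thus ?thesis using rat_abs_mult[OF p, of "-1" x] by simp
qed

lemma rat_abs_ultra: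
  assumes p: "prime p"
  shows "rat_abs p (x + y) \<le> max (rat_abs p x) (rat_abs p y)"
proof (cases "x = 0 \<or> y = 0 \<or> x + y = 0")
  case True
  then show ?thesis by (auto simp: le_max_iff_disj)
next
  case False
  have "real p \<ge> 1" using p prime_ge_1_nat by auto
  thus ?thesis
    using False rat_ord_add[OF p, of x y]
    by (auto simp: rat_abs_def le_max_iff_disj min_le_iff_disj intro: power_int_increasing)
qed

lemma rat_abs_triangle: "prime p \<Longrightarrow> rat_abs p (x + y) \<le> rat_abs p x + rat_abs p y"
  using rat_abs_ultra[of p x y] rat_abs_nonneg[of p x] rat_abs_nonneg[of p y] by linarith

lemma rat_abs_diff: "prime p \<Longrightarrow> \<bar>rat_abs p x - rat_abs p y\<bar> \<le> rat_abs p (x - y)"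
  using rat_abs_triangle[of p "x - y" y] rat_abs_triangle[of p "y - x" x] rat_abs_minus[of p "x - y"]
  by (simp add: abs_le_iff)

lemma rat_abs_inverse: assumes "prime p" shows "rat_abs p (inverse x) = inverse (rat_abs p x)"
proof (cases "x = 0")
  case False
  hence "rat_abs p x * rat_abs p (inverse x) = 1"
    by (simp flip: rat_abs_mult[OF assms])
  thus ?thesis by (metis inverse_unique)
qed auto


section \<open>The field of p-adic numbers\<close>

text \<open>
  The prime is the cardinality of the type parameter. \<open>'p padic\<close> is the completion of the
  rationals with respect to \<open>rat_abs CARD('p)\<close>: Cauchy sequences modulo null sequences.
\<close>

definition p_cauchy :: "nat \<Rightarrow> (nat \<Rightarrow> rat) \<Rightarrow> bool" where
  "p_cauchy p X \<longleftrightarrow> (\<forall>e>0. \<exists>N. \<forall>m\<ge>N. \<forall>n\<ge>N. rat_abs p (X m - X n) < e)"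

definition p_null :: "nat \<Rightarrow> (nat \<Rightarrow> rat) \<Rightarrow> bool" where
  "p_null p X \<longleftrightarrow> (\<lambda>n. rat_abs p (X n)) \<longlonglongrightarrow> 0"

lemma p_null_add:
  assumes p: "prime p" and "p_null p X" "p_null p Y"
  shows "p_null p (\<lambda>n. X n + Y n)"
  unfolding p_null_def
proof (rule tendsto_sandwich[OF _ _ tendsto_const])
  show "(\<lambda>n. rat_abs p (X n) + rat_abs p (Y n)) \<longlonglongrightarrow> 0"
    using tendsto_add[OF assms(2,3)[unfolded p_null_def]] by simp
qed (auto simp: rat_abs_triangle[OF p])

lemma p_null_minus: "prime p \<Longrightarrow> p_null p X \<Longrightarrow> p_null p (\<lambda>n. - X n)"
  by (simp add: p_null_def rat_abs_minus)

lemma p_null_diff: "prime p \<Longrightarrow> p_null p X \<Longrightarrow> p_null p Y \<Longrightarrow> p_null p (\<lambda>n. X n - Y n)"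
  using p_null_add[of p X "\<lambda>n. - Y n"] p_null_minus[of p Y] by simp

lemma p_cauchy_const [simp]: "p_cauchy p (\<lambda>_. c)"
  by (simp add: p_cauchy_def)

lemma p_cauchy_add:
  assumes p: "prime p" and X: "p_cauchy p X" and Y: "p_cauchy p Y"
  shows "p_cauchy p (\<lambda>n. X n + Y n)"
  unfolding p_cauchy_def
proof (intro allI impI)
  fix e :: real assume e: "e > 0"
  obtain N M where N: "\<forall>m\<ge>N. \<forall>n\<ge>N. rat_abs p (X m - X n) < e"
    and M: "\<forall>m\<ge>M. \<forall>n\<ge>M. rat_abs p (Y m - Y n) < e"
    using X Y e unfolding p_cauchy_def by meson
  have "rat_abs p (X m + Y m - (X n + Y n)) < e" if "m \<ge> max N M" "n \<ge> max N M" for m n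
    using N[rule_format, of m n] M[rule_format, of m n] that
      rat_abs_ultra[OF p, of "X m - X n" "Y m - Y n"]
    by (simp add: algebra_simps)
  thus "\<exists>N. \<forall>m\<ge>N. \<forall>n\<ge>N. rat_abs p (X m + Y m - (X n + Y n)) < e" by blast
qed

lemma p_cauchy_minus: assumes "prime p" "p_cauchy p X" shows "p_cauchy p (\<lambda>n. - X n)"
proof -
  have "- X m - - X n = - (X m - X n)" for m n by simp
  thus ?thesis using assms unfolding p_cauchy_def by (metis rat_abs_minus)
qed

lemma p_cauchy_diff: "prime p \<Longrightarrow> p_cauchy p X \<Longrightarrow> p_cauchy p Y \<Longrightarrow> p_cauchy p (\<lambda>n. X n - Y n)"
  using p_cauchy_add[of p X "\<lambda>n. - Y n"] p_cauchy_minus[of p Y] by simp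

lemma p_cauchy_bounded:
  assumes p: "prime p" and X: "p_cauchy p X"
  obtains B where "B > 0" "\<And>n. rat_abs p (X n) \<le> B"
proof -
  obtain N where N: "\<And>m n. m \<ge> N \<Longrightarrow> n \<ge> N \<Longrightarrow> rat_abs p (X m - X n) < 1"
    using X unfolding p_cauchy_def by (meson zero_less_one)
  define B where "B = 1 + (\<Sum>n\<le>N. rat_abs p (X n))"
  have le: "rat_abs p (X n) \<le> (\<Sum>n\<le>N. rat_abs p (X n))" if "n \<le> N" for n
    by (rule member_le_sum) (use that in auto)
  have "rat_abs p (X n) \<le> B" for n
  proof (cases "n \<le> N")
    case True
    thus ?thesis using le[of n] by (simp add: B_def)
  next
    case False
    thus ?thesis using N[of n N] le[of N] rat_abs_triangle[OF p, of "X n - X N" "X N"]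
      by (simp add: B_def)
  qed
  moreover have "B > 0" unfolding B_def by (intro add_pos_nonneg sum_nonneg) auto
  ultimately show ?thesis using that by blast
qed

lemma p_cauchy_mult:
  assumes p: "prime p" and X: "p_cauchy p X" and Y: "p_cauchy p Y"
  shows "p_cauchy p (\<lambda>n. X n * Y n)"
  unfolding p_cauchy_def
proof (intro allI impI)
  fix e :: real assume e: "e > 0"
  obtain B where B: "B > 0" "\<And>n. rat_abs p (X n) \<le> B" using p_cauchy_bounded[OF p X] by blast
  obtain C where C: "C > 0" "\<And>n. rat_abs p (Y n) \<le> C" using p_cauchy_bounded[OF p Y] by blast
  have "e / C > 0" "e / B > 0" using e B C by auto
  then obtain N M where N: "\<forall>m\<ge>N. \<forall>n\<ge>N. rat_abs p (X m - X n) < e / C"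
    and M: "\<forall>m\<ge>M. \<forall>n\<ge>M. rat_abs p (Y m - Y n) < e / B"
    using X Y unfolding p_cauchy_def by meson
  have "rat_abs p (X m * Y m - X n * Y n) < e" if "m \<ge> max N M" "n \<ge> max N M" for m n
  proof -
    have eq: "X m * Y m - X n * Y n = X m * (Y m - Y n) + (X m - X n) * Y n"
      by (simp add: algebra_simps)
    have "rat_abs p (X m) * rat_abs p (Y m - Y n) \<le> B * rat_abs p (Y m - Y n)"
      using B by (intro mult_right_mono) auto
    also have "\<dots> < B * (e / B)" using M that B by (intro mult_strict_left_mono) auto
    finally have 1: "rat_abs p (X m * (Y m - Y n)) < e" using B by (simp add: rat_abs_mult[OF p])
    have "rat_abs p (X m - X n) * rat_abs p (Y n) \<le> rat_abs p (X m - X n) * C"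
      using C by (intro mult_left_mono) auto
    also have "\<dots> < (e / C) * C" using N that C by (intro mult_strict_right_mono) auto
    finally have 2: "rat_abs p ((X m - X n) * Y n) < e" using C by (simp add: rat_abs_mult[OF p])
    show ?thesis using 1 2 rat_abs_ultra[OF p, of "X m * (Y m - Y n)" "(X m - X n) * Y n"]
      by (simp add: eq)
  qed
  thus "\<exists>N. \<forall>m\<ge>N. \<forall>n\<ge>N. rat_abs p (X m * Y m - X n * Y n) < e" by blast
qed

lemma p_null_mult_cauchy:
  assumes p: "prime p" and X: "p_null p X" and Y: "p_cauchy p Y"
  shows "p_null p (\<lambda>n. X n * Y n)"
proof -
  obtain C where C: "C > 0" "\<And>n. rat_abs p (Y n) \<le> C" using p_cauchy_bounded[OF p Y] by blast
  have "(\<lambda>n. rat_abs p (X n) * C) \<longlonglongrightarrow> 0"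
    using tendsto_mult[OF X[unfolded p_null_def] tendsto_const[of C]] by simp
  thus ?thesis unfolding p_null_def
    by (rule tendsto_sandwich[OF _ _ tendsto_const, rotated 2])
       (auto simp: rat_abs_mult[OF p] C mult_left_mono)
qed

lemma p_cauchy_away_from_0:
  assumes p: "prime p" and X: "p_cauchy p X" and nn: "\<not> p_null p X"
  obtains c N where "c > 0" "\<And>n. n \<ge> N \<Longrightarrow> rat_abs p (X n) \<ge> c"
proof -
  obtain e where e: "e > 0" "\<And>N. \<exists>n\<ge>N. rat_abs p (X n) \<ge> e"
    using nn unfolding p_null_def LIMSEQ_iff by (fastforce simp: not_less)
  have "e / 2 > 0" using e by simp
  then obtain N where N: "\<And>m n. m \<ge> N \<Longrightarrow> n \<ge> N \<Longrightarrow> rat_abs p (X m - X n) < e / 2"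
    using X unfolding p_cauchy_def by meson
  obtain m where m: "m \<ge> N" "rat_abs p (X m) \<ge> e" using e by blast
  have "rat_abs p (X n) \<ge> e / 2" if "n \<ge> N" for n
    using N[OF m(1) that] m(2) rat_abs_diff[OF p, of "X m" "X n"] by simp
  thus ?thesis using that[of "e/2" N] e by simp
qed

lemma p_cauchy_inverse:
  assumes p: "prime p" and X: "p_cauchy p X" and nn: "\<not> p_null p X"
  shows "p_cauchy p (\<lambda>n. inverse (X n))"
  unfolding p_cauchy_def
proof (intro allI impI)
  fix e :: real assume e: "e > 0"
  obtain c M where c: "c > 0" "\<And>n. n \<ge> M \<Longrightarrow> rat_abs p (X n) \<ge> c"
    using p_cauchy_away_from_0[OF p X nn] by blast
  have "e * c ^ 2 > 0" using e c by simp
  then obtain N where N: "\<And>m n. m \<ge> N \<Longrightarrow> n \<ge> N \<Longrightarrow> rat_abs p (X m - X n) < e * c ^ 2"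
    using X unfolding p_cauchy_def by meson
  have "rat_abs p (inverse (X m) - inverse (X n)) < e" if "m \<ge> max N M" "n \<ge> max N M" for m n
  proof -
    have cc: "rat_abs p (X m) \<ge> c" "rat_abs p (X n) \<ge> c" using c that by auto
    hence nz: "X m \<noteq> 0" "X n \<noteq> 0" using c(1) by auto
    have eq: "inverse (X m) - inverse (X n) = (X n - X m) * inverse (X m * X n)"
      using nz by (simp add: field_simps)
    have pos: "rat_abs p (X m) * rat_abs p (X n) > 0"
      using cc c(1) by (intro mult_pos_pos) linarith+
    have "rat_abs p (X n - X m) < e * c ^ 2" using N that by auto
    also have "\<dots> \<le> e * (rat_abs p (X m) * rat_abs p (X n))"
      using cc c(1) e by (auto simp: power2_eq_square intro!: mult_mono)
    finally show ?thesis using pos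
      unfolding eq rat_abs_mult[OF p] rat_abs_inverse[OF p]
      by (metis divide_inverse pos_divide_less_eq)
  qed
  thus "\<exists>N. \<forall>m\<ge>N. \<forall>n\<ge>N. rat_abs p (inverse (X m) - inverse (X n)) < e" by blast
qed

lemma p_null_inverse_diff:
  assumes p: "prime p" and X: "p_cauchy p X" "\<not> p_null p X" and Y: "p_cauchy p Y" "\<not> p_null p Y"
    and XY: "p_null p (\<lambda>n. X n - Y n)"
  shows "p_null p (\<lambda>n. inverse (X n) - inverse (Y n))"
proof -
  obtain c M where c: "c > 0" "\<And>n. n \<ge> M \<Longrightarrow> rat_abs p (X n) \<ge> c"
    using p_cauchy_away_from_0[OF p X] by blast
  obtain d N where d: "d > 0" "\<And>n. n \<ge> N \<Longrightarrow> rat_abs p (Y n) \<ge> d"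
    using p_cauchy_away_from_0[OF p Y] by blast
  have ev: "\<forall>\<^sub>F n in sequentially.
      - rat_abs p ((X n - Y n) * (inverse (X n) * inverse (Y n))) = - rat_abs p (inverse (X n) - inverse (Y n))"
    using eventually_ge_at_top[of "max M N"]
  proof eventually_elim
    case (elim n)
    hence "X n \<noteq> 0" "Y n \<noteq> 0" using c d by (metis max.bounded_iff not_less rat_abs_0)+
    hence "inverse (X n) - inverse (Y n) = - ((X n - Y n) * (inverse (X n) * inverse (Y n)))"
      by (simp add: field_simps)
    thus ?case by (metis rat_abs_minus[OF p])
  qed
  have "p_null p (\<lambda>n. (X n - Y n) * (inverse (X n) * inverse (Y n)))"
    by (intro p_null_mult_cauchy p_cauchy_mult p_cauchy_inverse assms)
  thus ?thesis unfolding p_null_def using tendsto_cong[OF ev, of 0]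
    by (simp only: tendsto_minus_cancel_left[symmetric] minus_zero)
qed

lemma p_null_imp_cauchy_mult_not:
  assumes p: "prime p" and "p_null p X" "p_cauchy p Y" "\<forall>\<^sub>F n in sequentially. X n * Y n = 1"
  shows False
proof -
  have "(\<lambda>n. rat_abs p (X n * Y n)) \<longlonglongrightarrow> 0"
    using p_null_mult_cauchy[OF assms(1-3)] by (simp add: p_null_def)
  moreover have "(\<lambda>n. rat_abs p (X n * Y n)) \<longlonglongrightarrow> 1"
    by (rule tendsto_eventually) (use assms(4) in eventually_elim, simp)
  ultimately show False using LIMSEQ_unique by fastforce
qed

typedef (overloaded) 'p cauchy_seq = "{X. p_cauchy CARD('p::prime_card) X}"
  by (rule exI[of _ "\<lambda>_. 0"]) simp

setup_lifting type_definition_cauchy_seq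

instantiation cauchy_seq :: (prime_card) comm_ring_1
begin

lift_definition zero_cauchy_seq :: "'a cauchy_seq" is "\<lambda>_. 0" by simp
lift_definition one_cauchy_seq :: "'a cauchy_seq" is "\<lambda>_. 1" by simp
lift_definition plus_cauchy_seq :: "'a cauchy_seq \<Rightarrow> 'a cauchy_seq \<Rightarrow> 'a cauchy_seq"
  is "\<lambda>X Y n. X n + Y n" by (rule p_cauchy_add[OF prime_card])
lift_definition minus_cauchy_seq :: "'a cauchy_seq \<Rightarrow> 'a cauchy_seq \<Rightarrow> 'a cauchy_seq"
  is "\<lambda>X Y n. X n - Y n" by (rule p_cauchy_diff[OF prime_card])
lift_definition uminus_cauchy_seq :: "'a cauchy_seq \<Rightarrow> 'a cauchy_seq"
  is "\<lambda>X n. - X n" by (rule p_cauchy_minus[OF prime_card])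
lift_definition times_cauchy_seq :: "'a cauchy_seq \<Rightarrow> 'a cauchy_seq \<Rightarrow> 'a cauchy_seq"
  is "\<lambda>X Y n. X n * Y n" by (rule p_cauchy_mult[OF prime_card])

instance
  by standard (transfer; auto simp: algebra_simps fun_eq_iff)+

end

lift_definition null_seq :: "'p::prime_card cauchy_seq \<Rightarrow> bool" is "p_null CARD('p)" .

lift_definition inv_seq :: "'p::prime_card cauchy_seq \<Rightarrow> 'p cauchy_seq"
  is "\<lambda>X. if p_null CARD('p) X then (\<lambda>_. 0) else (\<lambda>n. inverse (X n))"
  by (auto intro: p_cauchy_inverse[OF prime_card])

lemma null_seq_0 [simp]: "null_seq 0"
  by transfer (simp add: p_null_def)

lemma null_seq_1 [simp]: "\<not> null_seq 1"
  by transfer (auto simp: p_null_def dest: LIMSEQ_unique[OF tendsto_const])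

lemma null_seq_add: "null_seq X \<Longrightarrow> null_seq Y \<Longrightarrow> null_seq (X + Y)"
  by transfer (rule p_null_add[OF prime_card])

lemma null_seq_minus: "null_seq X \<Longrightarrow> null_seq (- X)"
  by transfer (rule p_null_minus[OF prime_card])

lemma null_seq_mult: "null_seq X \<Longrightarrow> null_seq (X * Y)"
  by transfer (rule p_null_mult_cauchy[OF prime_card])

lemma null_seq_inv_diff:
  "\<not> null_seq X \<Longrightarrow> \<not> null_seq Y \<Longrightarrow> null_seq (X - Y) \<Longrightarrow> null_seq (inv_seq X - inv_seq Y)"
  by transfer (auto intro: p_null_inverse_diff[OF prime_card])

lemma null_seq_inv_mult: "\<not> null_seq X \<Longrightarrow> null_seq (inv_seq X * X - 1)"
proof transfer
  fix X assume X: "p_cauchy CARD('a) X" "\<not> p_null CARD('a) X"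
  obtain c M where c: "c > 0" "\<And>n. n \<ge> M \<Longrightarrow> rat_abs CARD('a) (X n) \<ge> c"
    using p_cauchy_away_from_0[OF prime_card X] by blast
  have "\<forall>\<^sub>F n in sequentially. rat_abs CARD('a) (inverse (X n) * X n - 1) = 0"
    using eventually_ge_at_top[of M]
  proof eventually_elim
    case (elim n)
    hence "X n \<noteq> 0" using c by (metis not_less rat_abs_0)
    thus ?case by simp
  qed
  thus "p_null CARD('a) (\<lambda>n. (if p_null CARD('a) X then \<lambda>_. 0 else (\<lambda>n. inverse (X n))) n * X n - 1)"
    using X by (simp add: p_null_def tendsto_eventually)
qed

definition padic_rel :: "'p::prime_card cauchy_seq \<Rightarrow> 'p cauchy_seq \<Rightarrow> bool" where
  "padic_rel X Y \<longleftrightarrow> null_seq (X - Y)"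

lemma padic_rel_sym: "padic_rel X Y \<Longrightarrow> padic_rel Y X"
  using null_seq_minus[of "X - Y"] by (simp add: padic_rel_def)

lemma padic_rel_trans: "padic_rel X Y \<Longrightarrow> padic_rel Y Z \<Longrightarrow> padic_rel X Z"
  using null_seq_add[of "X - Y" "Y - Z"] by (simp add: padic_rel_def)

lemma padic_rel_refl [simp]: "padic_rel X X"
  by (simp add: padic_rel_def)

lemma padic_rel_null: "padic_rel X Y \<Longrightarrow> null_seq X \<longleftrightarrow> null_seq Y"
  using null_seq_add[of "X - Y" Y] null_seq_add[of "Y - X" X] padic_rel_sym[of X Y]
  by (auto simp: padic_rel_def)

quotient_type (overloaded) 'p padic = "'p::prime_card cauchy_seq" / padic_rel
  by (auto intro!: equivpI reflpI sympI transpI intro: padic_rel_sym padic_rel_trans)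

instantiation padic :: (prime_card) field
begin

lift_definition zero_padic :: "'a padic" is 0 .
lift_definition one_padic :: "'a padic" is 1 .
lift_definition plus_padic :: "'a padic \<Rightarrow> 'a padic \<Rightarrow> 'a padic" is "(+)"
  using null_seq_add by (fastforce simp: padic_rel_def algebra_simps)
lift_definition minus_padic :: "'a padic \<Rightarrow> 'a padic \<Rightarrow> 'a padic" is "(-)"
proof -
  fix X Y Z W :: "'a cauchy_seq" assume "padic_rel X Y" "padic_rel Z W"
  thus "padic_rel (X - Z) (Y - W)"
    using null_seq_add[OF _ null_seq_minus, of "X - Y" "Z - W"] by (simp add: padic_rel_def algebra_simps)
qed
lift_definition uminus_padic :: "'a padic \<Rightarrow> 'a padic" is "uminus"
  by (simp add: padic_rel_def) (metis null_seq_minus minus_diff_eq)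
lift_definition times_padic :: "'a padic \<Rightarrow> 'a padic \<Rightarrow> 'a padic" is "(*)"
proof -
  fix X Y Z W :: "'a cauchy_seq" assume "padic_rel X Y" "padic_rel Z W"
  thus "padic_rel (X * Z) (Y * W)"
    using null_seq_add[OF null_seq_mult null_seq_mult, of "X - Y" "Z - W" Z Y]
    by (simp add: padic_rel_def algebra_simps)
qed
lift_definition inverse_padic :: "'a padic \<Rightarrow> 'a padic" is inv_seq
proof -
  fix X Y :: "'a cauchy_seq" assume *: "padic_rel X Y"
  show "padic_rel (inv_seq X) (inv_seq Y)"
  proof (cases "null_seq X")
    case True
    with * have "null_seq Y" using padic_rel_null by blast
    with True have "inv_seq X = inv_seq Y" by transfer simp
    thus ?thesis by simp
  next
    case False
    with * show ?thesis using null_seq_inv_diff padic_rel_null unfolding padic_rel_def by blast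
  qed
qed
definition divide_padic :: "'a padic \<Rightarrow> 'a padic \<Rightarrow> 'a padic" where
  "divide_padic x y = x * inverse y"

instance
proof
  fix a b c :: "'a padic"
  show "a * b * c = a * (b * c)" "a + b + c = a + (b + c)" "(a + b) * c = a * c + b * c"
       "a * b = b * a" "a + b = b + a" "a - b = a + - b"
    by (transfer; simp add: algebra_simps)+
  show "1 * a = a" "0 + a = a" "- a + a = 0" by (transfer; simp)+
  show "(0::'a padic) \<noteq> 1"
    using null_seq_minus[of "- 1 :: 'a cauchy_seq"] by transfer (auto simp: padic_rel_def)
  show "a \<noteq> 0 \<Longrightarrow> inverse a * a = 1"
    by transfer (simp add: padic_rel_def null_seq_inv_mult)
  show "inverse (0::'a padic) = 0"
    by transfer (simp add: padic_rel_def, transfer, simp add: p_null_def)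
  show "a div b = a * inverse b" by (rule divide_padic_def)
qed

end

text \<open>The absolute value, extended by continuity.\<close>

lift_definition seq_norm :: "'p::prime_card cauchy_seq \<Rightarrow> real"
  is "\<lambda>X. lim (\<lambda>n. rat_abs CARD('p) (X n))" .

lemma p_cauchy_abs_convergent:
  assumes p: "prime p" and X: "p_cauchy p X"
  shows "convergent (\<lambda>n. rat_abs p (X n))"
proof -
  have "Cauchy (\<lambda>n. rat_abs p (X n))"
    unfolding Cauchy_def dist_real_def
    using X rat_abs_diff[OF p] unfolding p_cauchy_def by (meson le_less_trans)
  thus ?thesis by (simp add: Cauchy_convergent_iff)
qed

lemma p_cauchy_abs_LIMSEQ:
  "prime p \<Longrightarrow> p_cauchy p X \<Longrightarrow> (\<lambda>n. rat_abs p (X n)) \<longlonglongrightarrow> lim (\<lambda>n. rat_abs p (X n))"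
  using p_cauchy_abs_convergent convergent_LIMSEQ_iff by blast

lemma seq_norm_cong: "padic_rel X Y \<Longrightarrow> seq_norm X = seq_norm Y"
  unfolding padic_rel_def
proof transfer
  fix X Y assume *: "p_cauchy CARD('a) X" "p_cauchy CARD('a) Y" "p_null CARD('a) (\<lambda>n. X n - Y n)"
  have "(\<lambda>n. rat_abs CARD('a) (X n) - rat_abs CARD('a) (Y n)) \<longlonglongrightarrow> 0"
    using rat_abs_diff[OF prime_card]
    by (intro Lim_null_comparison[OF _ *(3)[unfolded p_null_def]]) (auto intro!: always_eventually)
  moreover have "(\<lambda>n. rat_abs CARD('a) (X n) - rat_abs CARD('a) (Y n))
      \<longlonglongrightarrow> lim (\<lambda>n. rat_abs CARD('a) (X n)) - lim (\<lambda>n. rat_abs CARD('a) (Y n))"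
    using * by (intro tendsto_diff p_cauchy_abs_LIMSEQ prime_card)
  ultimately show "lim (\<lambda>n. rat_abs CARD('a) (X n)) = lim (\<lambda>n. rat_abs CARD('a) (Y n))"
    using LIMSEQ_unique by fastforce
qed

lemma seq_norm_nonneg: "seq_norm X \<ge> 0"
  by transfer (rule LIMSEQ_le_const[OF p_cauchy_abs_LIMSEQ[OF prime_card]], auto)

lemma seq_norm_eq_0_iff: "seq_norm X = 0 \<longleftrightarrow> null_seq X"
  by transfer (metis p_null_def p_cauchy_abs_LIMSEQ[OF prime_card] limI)

lemma seq_norm_mult: "seq_norm (X * Y) = seq_norm X * seq_norm Y"
proof transfer
  fix X Y assume *: "p_cauchy CARD('a) X" "p_cauchy CARD('a) Y"
  show "lim (\<lambda>n. rat_abs CARD('a) (X n * Y n)) =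
      lim (\<lambda>n. rat_abs CARD('a) (X n)) * lim (\<lambda>n. rat_abs CARD('a) (Y n))"
    unfolding rat_abs_mult[OF prime_card]
    by (intro limI tendsto_mult p_cauchy_abs_LIMSEQ prime_card *)
qed

lemma seq_norm_ultra: "seq_norm (X + Y) \<le> max (seq_norm X) (seq_norm Y)"
proof transfer
  fix X Y assume *: "p_cauchy CARD('a) X" "p_cauchy CARD('a) Y"
  show "lim (\<lambda>n. rat_abs CARD('a) (X n + Y n)) \<le>
      max (lim (\<lambda>n. rat_abs CARD('a) (X n))) (lim (\<lambda>n. rat_abs CARD('a) (Y n)))"
  proof (rule LIMSEQ_le)
    show "(\<lambda>n. rat_abs CARD('a) (X n + Y n)) \<longlonglongrightarrow> lim (\<lambda>n. rat_abs CARD('a) (X n + Y n))"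
      by (intro p_cauchy_abs_LIMSEQ p_cauchy_add prime_card *)
    show "(\<lambda>n. max (rat_abs CARD('a) (X n)) (rat_abs CARD('a) (Y n)))
      \<longlonglongrightarrow> max (lim (\<lambda>n. rat_abs CARD('a) (X n))) (lim (\<lambda>n. rat_abs CARD('a) (Y n)))"
      by (intro tendsto_max p_cauchy_abs_LIMSEQ prime_card *)
  qed (use rat_abs_ultra[OF prime_card] in blast)
qed

lemma seq_norm_minus: "seq_norm (- X) = seq_norm X"
  by transfer (simp add: rat_abs_minus[OF prime_card])

lift_definition padic_abs :: "'p::prime_card padic \<Rightarrow> real" is seq_norm
  by (rule seq_norm_cong)

instantiation padic :: (prime_card) metric_space
begin

definition dist_padic :: "'a padic \<Rightarrow> 'a padic \<Rightarrow> real" where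
  "dist_padic x y = padic_abs (x - y)"

definition uniformity_padic :: "('a padic \<times> 'a padic) filter" where
  "uniformity_padic = (INF e\<in>{0 <..}. principal {(x, y). dist x y < e})"

definition open_padic :: "'a padic set \<Rightarrow> bool" where
  "open_padic U \<longleftrightarrow> (\<forall>x\<in>U. eventually (\<lambda>(x', y). x' = x \<longrightarrow> y \<in> U) uniformity)"

instance
proof
  fix x y z :: "'a padic" and U :: "'a padic set"
  show "uniformity = (INF e\<in>{0 <..}. principal {(x :: 'a padic, y). dist x y < e})"
    by (rule uniformity_padic_def)
  show "open U \<longleftrightarrow> (\<forall>x\<in>U. eventually (\<lambda>(x', y). x' = x \<longrightarrow> y \<in> U) uniformity)"
    by (rule open_padic_def)
  show "dist x y = 0 \<longleftrightarrow> x = y"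
    unfolding dist_padic_def by transfer (simp add: padic_rel_def seq_norm_eq_0_iff)
  have nn: "padic_abs a \<ge> 0" for a :: "'a padic" by transfer (rule seq_norm_nonneg)
  have um: "padic_abs (a + b) \<le> max (padic_abs a) (padic_abs b)" for a b :: "'a padic"
    by transfer (rule seq_norm_ultra)
  have mi: "padic_abs (- a) = padic_abs a" for a :: "'a padic" by transfer (rule seq_norm_minus)
  show "dist x y \<le> dist x z + dist y z"
    using um[of "x - z" "- (y - z)"] nn[of "x - z"] nn[of "y - z"] mi[of "y - z"]
    by (simp add: dist_padic_def)
qed

end

lemma padic_abs_nonneg [simp]: "padic_abs (x :: 'p::prime_card padic) \<ge> 0"
  by transfer (rule seq_norm_nonneg)

lemma padic_abs_eq_0_iff [simp]: "padic_abs (x :: 'p::prime_card padic) = 0 \<longleftrightarrow> x = 0"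
  by transfer (simp add: padic_rel_def seq_norm_eq_0_iff)

lemma padic_abs_0 [simp]: "padic_abs (0 :: 'p::prime_card padic) = 0"
  by simp

lemma padic_abs_mult: "padic_abs (x * y :: 'p::prime_card padic) = padic_abs x * padic_abs y"
  by transfer (rule seq_norm_mult)

lemma padic_abs_ultra: "padic_abs (x + y :: 'p::prime_card padic) \<le> max (padic_abs x) (padic_abs y)"
  by transfer (rule seq_norm_ultra)

lemma padic_abs_minus [simp]: "padic_abs (- x :: 'p::prime_card padic) = padic_abs x"
  by transfer (rule seq_norm_minus)

lemma padic_abs_minus_commute: "padic_abs (x - y :: 'p::prime_card padic) = padic_abs (y - x)"
  using padic_abs_minus[of "x - y"] by simp

lemma padic_abs_ultra_diff: "padic_abs (x - y :: 'p::prime_card padic) \<le> max (padic_abs x) (padic_abs y)"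
  using padic_abs_ultra[of x "- y"] by simp

lemma padic_abs_triangle: "padic_abs (x + y :: 'p::prime_card padic) \<le> padic_abs x + padic_abs y"
  using padic_abs_ultra[of x y] padic_abs_nonneg[of x] padic_abs_nonneg[of y] by linarith

lemma padic_abs_1 [simp]: "padic_abs (1 :: 'p::prime_card padic) = 1"
  using padic_abs_mult[of "1 :: 'p padic" 1] padic_abs_eq_0_iff[of "1 :: 'p padic"] by fastforce

lemma padic_abs_dominant:
  fixes x y :: "'p::prime_card padic"
  assumes "padic_abs (x - y) < padic_abs x" shows "padic_abs y = padic_abs x"
  using padic_abs_ultra_diff[of x "x - y"] padic_abs_ultra[of "x - y" y] assms by auto

lift_definition rat_seq :: "rat \<Rightarrow> 'p::prime_card cauchy_seq" is "\<lambda>q _. q" by simp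

lift_definition padic_of_rat :: "rat \<Rightarrow> 'p::prime_card padic" is rat_seq .

lemma padic_of_rat_add: "padic_of_rat (x + y) = (padic_of_rat x + padic_of_rat y :: 'p::prime_card padic)"
proof transfer
  fix x y
  have "rat_seq (x + y) = (rat_seq x + rat_seq y :: 'p cauchy_seq)" by transfer simp
  thus "padic_rel (rat_seq (x + y)) (rat_seq x + rat_seq y :: 'p cauchy_seq)" by simp
qed

lemma padic_of_rat_mult: "padic_of_rat (x * y) = (padic_of_rat x * padic_of_rat y :: 'p::prime_card padic)"
proof transfer
  fix x y
  have "rat_seq (x * y) = (rat_seq x * rat_seq y :: 'p cauchy_seq)" by transfer simp
  thus "padic_rel (rat_seq (x * y)) (rat_seq x * rat_seq y :: 'p cauchy_seq)" by simp
qed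

lemma padic_of_rat_0: "padic_of_rat 0 = (0 :: 'p::prime_card padic)"
proof transfer
  have "rat_seq 0 = (0 :: 'p cauchy_seq)" by transfer simp
  thus "padic_rel (rat_seq 0) (0 :: 'p cauchy_seq)" by simp
qed

lemma padic_of_rat_1: "padic_of_rat 1 = (1 :: 'p::prime_card padic)"
proof transfer
  have "rat_seq 1 = (1 :: 'p cauchy_seq)" by transfer simp
  thus "padic_rel (rat_seq 1) (1 :: 'p cauchy_seq)" by simp
qed

lemma padic_abs_of_rat: "padic_abs (padic_of_rat q :: 'p::prime_card padic) = rat_abs CARD('p) q"
  by (transfer, transfer) simp

lemma padic_of_rat_of_nat: "padic_of_rat (of_nat n) = (of_nat n :: 'p::prime_card padic)"
  by (induction n) (auto simp: padic_of_rat_add padic_of_rat_0 padic_of_rat_1)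

lemma padic_of_nat_inj_aux:
  assumes "(of_nat m :: 'p::prime_card padic) = of_nat (m + k)"
  shows "k = 0"
proof -
  have "(of_nat m + of_nat k :: 'p padic) = of_nat m + 0"
    using assms by (simp only: of_nat_add add_0_right)
  hence "(of_nat k :: 'p padic) = 0" by (rule add_left_imp_eq)
  hence "padic_abs (padic_of_rat (of_nat k) :: 'p padic) = 0"
    by (simp only: padic_of_rat_of_nat padic_abs_0)
  hence "rat_abs CARD('p) (of_nat k) = 0"
    by (simp only: padic_abs_of_rat)
  thus ?thesis by (simp add: rat_abs_eq_0_iff[OF prime_card])
qed

lemma padic_inj_of_nat: "inj (of_nat :: nat \<Rightarrow> 'p::prime_card padic)"
proof (rule injI)
  fix m n assume eq: "(of_nat m :: 'p padic) = of_nat n"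
  show "m = n"
  proof (cases "m \<le> n")
    case True
    then obtain k where k: "n = m + k" using le_Suc_ex by blast
    show ?thesis using padic_of_nat_inj_aux[OF eq[unfolded k]] k by simp
  next
    case False
    hence "n \<le> m" by simp
    then obtain k where k: "m = n + k" using le_Suc_ex by blast
    show ?thesis using padic_of_nat_inj_aux[OF eq[symmetric, unfolded k]] k by simp
  qed
qed

instance padic :: (prime_card) field_char_0
  by (intro_classes, rule padic_inj_of_nat)

lemma padic_of_rat_minus: "padic_of_rat (- x) = (- padic_of_rat x :: 'p::prime_card padic)"
proof -
  have "padic_of_rat x + padic_of_rat (- x) = (0 :: 'p padic)"
    unfolding padic_of_rat_add[symmetric] add.right_inverse by (rule padic_of_rat_0)
  thus ?thesis by (rule minus_unique[symmetric])
qed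

lemma padic_of_rat_of_int: "padic_of_rat (of_int n) = (of_int n :: 'p::prime_card padic)"
proof (cases "n \<ge> 0")
  case True
  then obtain m where "n = int m" using nonneg_int_cases by blast
  thus ?thesis by (simp only: of_int_of_nat_eq padic_of_rat_of_nat)
next
  case False
  hence "n = - int (nat (- n))" by simp
  then obtain m where "n = - int m" ..
  thus ?thesis by (simp only: of_int_minus of_int_of_nat_eq padic_of_rat_of_nat padic_of_rat_minus)
qed

lemma padic_of_rat_eq: "padic_of_rat q = (of_rat q :: 'p::prime_card padic)"
proof (cases q)
  case (Fract a b)
  have q: "q = of_int a / of_int b" using Fract by (simp add: Fract_of_int_quotient)
  have b: "(of_int b :: 'p padic) \<noteq> 0" using Fract by simp
  have "q * of_int b = of_int a" unfolding q using Fract(2) by simp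
  hence "padic_of_rat (q * of_int b) = (padic_of_rat (of_int a) :: 'p padic)" by (rule arg_cong)
  hence "padic_of_rat q * of_int b = (of_int a :: 'p padic)"
    by (simp only: padic_of_rat_of_int padic_of_rat_mult)
  with b have "padic_of_rat q = (of_int a / of_int b :: 'p padic)" by (rule eq_divide_imp)
  thus ?thesis by (simp only: q of_rat_divide of_rat_of_int_eq)
qed

lemma padic_abs_of_rat': "padic_abs (of_rat q :: 'p::prime_card padic) = rat_abs CARD('p) q"
  unfolding padic_of_rat_eq[symmetric] by (rule padic_abs_of_rat)

lemma padic_LIMSEQ_iff:
  fixes l :: "'p::prime_card padic"
  shows "(f \<longlongrightarrow> l) F \<longleftrightarrow> ((\<lambda>x. padic_abs (f x - l)) \<longlongrightarrow> 0) F"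
  unfolding dist_padic_def[symmetric] by (rule tendsto_dist_iff)

instance padic :: (prime_card) topological_ab_group_add
proof
  fix a b :: "'a padic"
  have f: "((\<lambda>x. padic_abs (fst x - a)) \<longlongrightarrow> 0) (nhds a \<times>\<^sub>F nhds b)"
    using filterlim_fst[of "nhds a" "nhds b"] padic_LIMSEQ_iff[of fst a] by auto
  have s: "((\<lambda>x. padic_abs (snd x - b)) \<longlongrightarrow> 0) (nhds a \<times>\<^sub>F nhds b)"
    using filterlim_snd[of "nhds b" "nhds a"] padic_LIMSEQ_iff[of snd b] by auto
  show "((\<lambda>x. fst x + snd x) \<longlongrightarrow> a + b) (nhds a \<times>\<^sub>F nhds b)"
    unfolding padic_LIMSEQ_iff
  proof (rule tendsto_sandwich[OF _ _ tendsto_const])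
    show "((\<lambda>x. padic_abs (fst x - a) + padic_abs (snd x - b)) \<longlongrightarrow> 0) (nhds a \<times>\<^sub>F nhds b)"
      using tendsto_add[OF f s] by simp
    show "\<forall>\<^sub>F x in nhds a \<times>\<^sub>F nhds b. padic_abs (fst x + snd x - (a + b)) \<le> padic_abs (fst x - a) + padic_abs (snd x - b)"
      using padic_abs_triangle by (auto intro!: always_eventually simp: add_diff_add)
  qed auto
  show "(uminus \<longlongrightarrow> - a) (nhds a)"
    using padic_LIMSEQ_iff[of "\<lambda>x. x" a "nhds a"] filterlim_ident[of "nhds a"]
    by (simp add: padic_LIMSEQ_iff padic_abs_minus_commute)
qed

instance padic :: (prime_card) topological_semigroup_mult
proof
  fix a b :: "'a padic"
  have f: "((\<lambda>x. padic_abs (fst x - a)) \<longlongrightarrow> 0) (nhds a \<times>\<^sub>F nhds b)"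
    using filterlim_fst[of "nhds a" "nhds b"] padic_LIMSEQ_iff[of fst a] by auto
  have s: "((\<lambda>x. padic_abs (snd x - b)) \<longlongrightarrow> 0) (nhds a \<times>\<^sub>F nhds b)"
    using filterlim_snd[of "nhds b" "nhds a"] padic_LIMSEQ_iff[of snd b] by auto
  show "((\<lambda>x. fst x * snd x) \<longlongrightarrow> a * b) (nhds a \<times>\<^sub>F nhds b)"
    unfolding padic_LIMSEQ_iff
  proof (rule tendsto_sandwich[OF _ _ tendsto_const])
    show "((\<lambda>x. padic_abs (fst x - a) * (padic_abs (snd x - b) + padic_abs b) + padic_abs a * padic_abs (snd x - b)) \<longlongrightarrow> 0)
        (nhds a \<times>\<^sub>F nhds b)"
      by (rule tendsto_eq_intros f s refl)+ auto
    have "padic_abs (x * y - a * b) \<le> padic_abs (x - a) * (padic_abs (y - b) + padic_abs b) + padic_abs a * padic_abs (y - b)"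
      for x y :: "'a padic"
    proof -
      have "padic_abs (x * y - a * b) = padic_abs ((x - a) * ((y - b) + b) + a * (y - b))"
        by (simp add: algebra_simps)
      also have "\<dots> \<le> padic_abs (x - a) * padic_abs ((y - b) + b) + padic_abs a * padic_abs (y - b)"
        by (metis padic_abs_triangle padic_abs_mult)
      also have "\<dots> \<le> padic_abs (x - a) * (padic_abs (y - b) + padic_abs b) + padic_abs a * padic_abs (y - b)"
        by (intro add_right_mono mult_left_mono padic_abs_triangle) auto
      finally show ?thesis .
    qed
    thus "\<forall>\<^sub>F x in nhds a \<times>\<^sub>F nhds b. padic_abs (fst x * snd x - a * b)
        \<le> padic_abs (fst x - a) * (padic_abs (snd x - b) + padic_abs b) + padic_abs a * padic_abs (snd x - b)"
      by (auto intro!: always_eventually)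
  qed auto
qed

lemma cauchy_seq_LIMSEQ:
  fixes X :: "'p::prime_card cauchy_seq"
  shows "(\<lambda>n. of_rat (Rep_cauchy_seq X n)) \<longlonglongrightarrow> abs_padic X"
  unfolding padic_LIMSEQ_iff
proof (rule LIMSEQ_I)
  fix e :: real assume e: "e > 0"
  define Y where "Y = Rep_cauchy_seq X"
  have Y: "p_cauchy CARD('p) Y" using Rep_cauchy_seq[of X] by (simp add: Y_def)
  have "e / 2 > 0" using e by simp
  then obtain N where N: "\<And>m n. m \<ge> N \<Longrightarrow> n \<ge> N \<Longrightarrow> rat_abs CARD('p) (Y m - Y n) < e / 2"
    using Y unfolding p_cauchy_def by meson
  have "padic_abs (of_rat (Y n) - abs_padic X :: 'p padic) < e" if n: "n \<ge> N" for n
  proof -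
    have c: "p_cauchy CARD('p) (\<lambda>m. Y n - Y m)"
      by (intro p_cauchy_diff prime_card p_cauchy_const Y)
    have "padic_abs (of_rat (Y n) - abs_padic X :: 'p padic) = seq_norm (rat_seq (Y n) - X)"
      by (simp add: padic_of_rat_def minus_padic.abs_eq padic_abs.abs_eq flip: padic_of_rat_eq)
    also have "\<dots> = lim (\<lambda>m. rat_abs CARD('p) (Y n - Y m))"
      by (simp add: seq_norm.rep_eq minus_cauchy_seq.rep_eq rat_seq.rep_eq Y_def)
    also have "\<dots> \<le> e / 2"
      by (rule LIMSEQ_le_const2[OF p_cauchy_abs_LIMSEQ[OF prime_card c]])
         (use N[OF n] in \<open>force intro: less_imp_le\<close>)
    finally show ?thesis using e by simp
  qed
  thus "\<exists>N. \<forall>n\<ge>N. norm (padic_abs (of_rat (Rep_cauchy_seq X n) - abs_padic X :: 'p padic) - 0) < e"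
    by (auto simp: Y_def)
qed

lemma padic_rat_dense:
  fixes x :: "'p::prime_card padic"
  assumes "e > 0" obtains q where "padic_abs (x - of_rat q) < e"
proof -
  obtain X where X: "x = abs_padic X"
    by (rule that[OF Quotient3_abs_rep[OF Quotient3_padic, symmetric]])
  have "\<forall>\<^sub>F n in sequentially. padic_abs (of_rat (Rep_cauchy_seq X n) - x) < e"
    using cauchy_seq_LIMSEQ[of X] assms unfolding X padic_LIMSEQ_iff by (rule order_tendstoD(2))
  then obtain n where "padic_abs (of_rat (Rep_cauchy_seq X n) - x) < e"
    using eventually_happens by force
  thus ?thesis using that padic_abs_minus_commute by metis
qed

instance padic :: (prime_card) complete_space
proof
  fix X :: "nat \<Rightarrow> 'a padic" assume X: "Cauchy X"
  have "\<exists>q. padic_abs (X n - of_rat q) < inverse (real (Suc n))" for n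
    by (rule padic_rat_dense[of "inverse (real (Suc n))" "X n"]) auto
  then obtain q where q: "\<And>n. padic_abs (X n - of_rat (q n)) < inverse (real (Suc n))" by metis
  have "p_cauchy CARD('a) q"
    unfolding p_cauchy_def
  proof (intro allI impI)
    fix e :: real assume e: "e > 0"
    obtain N where N: "\<And>m n. m \<ge> N \<Longrightarrow> n \<ge> N \<Longrightarrow> padic_abs (X m - X n) < e"
      using X e unfolding Cauchy_def dist_padic_def by meson
    obtain M where M: "inverse (real (Suc M)) < e" using e reals_Archimedean by blast
    have d: "padic_abs (X n - of_rat (q n)) < e" if "n \<ge> M" for n
    proof -
      have "inverse (real (Suc n)) \<le> inverse (real (Suc M))" using that by simp
      thus ?thesis using q[of n] M by linarith
    qed
    have "rat_abs CARD('a) (q m - q n) < e" if "m \<ge> max N M" "n \<ge> max N M" for m n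
    proof -
      have "of_rat (q m - q n) = (X m - X n) - ((X m - of_rat (q m)) - (X n - of_rat (q n)))"
        by (simp add: of_rat_diff)
      hence "padic_abs (of_rat (q m - q n) :: 'a padic) < e"
        using padic_abs_ultra_diff[of "X m - X n" "(X m - of_rat (q m)) - (X n - of_rat (q n))"]
          padic_abs_ultra_diff[of "X m - of_rat (q m)" "X n - of_rat (q n)"] N[of m n] d[of m] d[of n] that
        by auto
      thus ?thesis by (simp add: padic_abs_of_rat')
    qed
    thus "\<exists>N. \<forall>m\<ge>N. \<forall>n\<ge>N. rat_abs CARD('a) (q m - q n) < e" by blast
  qed
  then obtain S :: "'a cauchy_seq" where S: "Rep_cauchy_seq S = q"
    using Abs_cauchy_seq_inverse by blast
  have 1: "(\<lambda>n. of_rat (q n)) \<longlonglongrightarrow> abs_padic S" using cauchy_seq_LIMSEQ[of S] by (simp add: S)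
  have le: "\<forall>\<^sub>F n in sequentially. padic_abs (X n - of_rat (q n) - 0) \<le> inverse (real (Suc n))"
    unfolding diff_zero by (intro always_eventually allI less_imp_le[OF q])
  have 2: "(\<lambda>n. X n - of_rat (q n)) \<longlonglongrightarrow> 0"
    unfolding padic_LIMSEQ_iff
    by (rule tendsto_sandwich[OF _ le tendsto_const LIMSEQ_inverse_real_of_nat]) simp
  have "(\<lambda>n. (X n - of_rat (q n)) + of_rat (q n)) \<longlonglongrightarrow> 0 + abs_padic S"
    by (rule tendsto_add[OF 2 1])
  thus "convergent X" by (auto simp: convergent_def)
qed

lemma padic_abs_sum_less:
  fixes f :: "'a \<Rightarrow> 'p::prime_card padic"
  assumes "e > 0" "\<And>i. i \<in> A \<Longrightarrow> padic_abs (f i) < e"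
  shows "padic_abs (sum f A) < e"
  using assms(2)
proof (induction A rule: infinite_finite_induct)
  case (insert x A)
  hence "padic_abs (f x) < e" "padic_abs (sum f A) < e" by auto
  thus ?case using insert.hyps padic_abs_ultra[of "f x" "sum f A"] by simp
qed (use assms(1) in auto)

lemma padic_summable_iff:
  fixes f :: "nat \<Rightarrow> 'p::prime_card padic"
  shows "summable f \<longleftrightarrow> f \<longlonglongrightarrow> 0"
proof
  assume "summable f"
  then obtain s where s: "(\<lambda>n. \<Sum>i<n. f i) \<longlonglongrightarrow> s" by (auto simp: summable_def sums_def)
  have "(\<lambda>n. (\<Sum>i<Suc n. f i) - (\<Sum>i<n. f i)) \<longlonglongrightarrow> s - s"
    by (intro tendsto_diff s LIMSEQ_Suc[OF s])
  thus "f \<longlonglongrightarrow> 0" by simp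
next
  assume f: "f \<longlonglongrightarrow> 0"
  have "Cauchy (\<lambda>n. \<Sum>i<n. f i)"
  proof (rule metric_CauchyI)
    fix e :: real assume e: "e > 0"
    obtain N where N: "\<And>n. n \<ge> N \<Longrightarrow> padic_abs (f n) < e"
      using f e by (auto simp: lim_sequentially dist_padic_def)
    have le: "padic_abs ((\<Sum>i<n. f i) - (\<Sum>i<m. f i)) < e" if "m \<ge> N" "n \<ge> m" for m n
    proof -
      have "(\<Sum>i<n. f i) - (\<Sum>i<m. f i) = (\<Sum>i=m..<n. f i)"
        using that by (simp add: sum_diff_nat_ivl atLeast0LessThan[symmetric])
      thus ?thesis using that N e by (auto intro!: padic_abs_sum_less)
    qed
    have "dist (\<Sum>i<m. f i) (\<Sum>i<n. f i) < e" if "m \<ge> N" "n \<ge> N" for m n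
      using le[of m n] le[of n m] that padic_abs_minus_commute[of "\<Sum>i<m. f i"]
      by (cases "m \<le> n") (auto simp: dist_padic_def)
    thus "\<exists>N. \<forall>m\<ge>N. \<forall>n\<ge>N. dist (\<Sum>i<m. f i) (\<Sum>i<n. f i) < e" by blast
  qed
  thus "summable f"
    by (simp add: summable_iff_convergent Cauchy_convergent_iff)
qed


subsection \<open>Order, residues and digits\<close>

definition padic_ord :: "'p::prime_card padic \<Rightarrow> int" where
  "padic_ord x = (THE k. padic_abs x = real CARD('p) powi (- k))"

lemma padic_abs_eq_powi_ord:
  fixes x :: "'p::prime_card padic"
  assumes "x \<noteq> 0"
  shows "padic_abs x = real CARD('p) powi (- padic_ord x)"
proof -
  have p: "1 < real CARD('p)" using prime_gt_1_nat[OF prime_card[where 'a = 'p]] by simp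
  have pos: "padic_abs x > 0" using assms padic_abs_nonneg[of x] padic_abs_eq_0_iff[of x] by linarith
  obtain q where "padic_abs (x - of_rat q) < padic_abs x" by (rule padic_rat_dense[OF pos])
  hence q: "padic_abs x = rat_abs CARD('p) q"
    using padic_abs_dominant[of x "of_rat q"] by (simp add: padic_abs_of_rat')
  hence "q \<noteq> 0" using pos by auto
  hence ex: "padic_abs x = real CARD('p) powi (- rat_ord CARD('p) q)" using q by (simp add: rat_abs_def)
  show ?thesis unfolding padic_ord_def
  proof (rule theI, rule ex)
    fix k assume "padic_abs x = real CARD('p) powi (- k)"
    from trans[OF this[symmetric] ex]
    have eq: "real CARD('p) powi (- k) = real CARD('p) powi (- rat_ord CARD('p) q)" .
    show "k = rat_ord CARD('p) q"
    proof (rule ccontr)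
      assume "k \<noteq> rat_ord CARD('p) q"
      hence "- rat_ord CARD('p) q < - k \<or> - k < - rat_ord CARD('p) q" by linarith
      thus False
      proof
        assume "- rat_ord CARD('p) q < - k"
        from power_int_strict_increasing[OF this p] show False unfolding eq by (rule less_irrefl[THEN notE])
      next
        assume "- k < - rat_ord CARD('p) q"
        from power_int_strict_increasing[OF this p] show False unfolding eq by (rule less_irrefl[THEN notE])
      qed
    qed
  qed
qed

lemma padic_abs_of_int_less_1_iff:
  "padic_abs (of_int a :: 'p::prime_card padic) < 1 \<longleftrightarrow> int CARD('p) dvd a"
proof (cases "a = 0")
  case False
  have p: "1 < real CARD('p)" using prime_gt_1_nat[OF prime_card[where 'a = 'p]] by simp
  have "padic_abs (of_int a :: 'p padic) = rat_abs CARD('p) (of_int a)"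
    using padic_abs_of_rat[of "of_int a", where 'p = 'p] by (simp only: padic_of_rat_of_int)
  also have "\<dots> = real CARD('p) powi (- int (multiplicity (int CARD('p)) a))"
    using False unfolding rat_abs_def rat_ord_def by simp
  also have "\<dots> < 1 \<longleftrightarrow> multiplicity (int CARD('p)) a > 0"
  proof (cases "multiplicity (int CARD('p)) a = 0")
    case False
    hence "real CARD('p) powi (- int (multiplicity (int CARD('p)) a)) < real CARD('p) powi 0"
      by (intro power_int_strict_increasing p) linarith
    thus ?thesis using False by (simp only: power_int_0_right neq0_conv)
  qed simp
  also have "\<dots> \<longleftrightarrow> int CARD('p) dvd a"
    using False prime_card_int[where 'a = 'p] by (simp add: prime_multiplicity_gt_zero_iff)
  finally show ?thesis .
qed auto

lemma padic_abs_of_int_le_1: "padic_abs (of_int a :: 'p::prime_card padic) \<le> 1"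
proof (cases "a = 0")
  case False
  have p: "1 < real CARD('p)" using prime_gt_1_nat[OF prime_card[where 'a = 'p]] by simp
  have "padic_abs (of_int a :: 'p padic) = rat_abs CARD('p) (of_int a)"
    using padic_abs_of_rat[of "of_int a", where 'p = 'p] by (simp only: padic_of_rat_of_int)
  also have "\<dots> = real CARD('p) powi (- int (multiplicity (int CARD('p)) a))"
    using False unfolding rat_abs_def rat_ord_def by simp
  also have "\<dots> \<le> real CARD('p) powi 0"
    by (rule power_int_increasing) (use p in auto)
  finally show ?thesis by simp
qed auto

lemma padic_residue_ex1:
  fixes u :: "'p::prime_card padic"
  assumes "padic_abs u \<le> 1"
  shows "\<exists>!r. r < CARD('p) \<and> padic_abs (u - of_nat r) < 1"
proof -
  let ?p = "int CARD('p)"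
  have p: "prime ?p" by (rule prime_card_int)
  obtain q where q: "padic_abs (u - of_rat q) < 1" by (rule padic_rat_dense[OF zero_less_one])
  obtain a b where ab: "q = Rat.Fract a b" "b > 0" "coprime a b" by (cases q) auto
  have "u - (u - of_rat q) = of_rat q" by simp
  hence nq: "padic_abs (of_rat q :: 'p padic) \<le> 1"
    using padic_abs_ultra_diff[of u "u - of_rat q"] assms q by simp
  have qb: "of_rat q * of_int b = (of_int a :: 'p padic)"
    using ab by (simp add: Fract_of_int_quotient of_rat_divide)
  have nb: "\<not> ?p dvd b"
  proof
    assume b: "?p dvd b"
    hence "padic_abs (of_int b :: 'p padic) < 1" by (simp add: padic_abs_of_int_less_1_iff)
    moreover have "padic_abs (of_int a :: 'p padic) \<le> 1 * padic_abs (of_int b :: 'p padic)"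
      unfolding qb[symmetric] padic_abs_mult by (intro mult_right_mono nq) auto
    ultimately have "padic_abs (of_int a :: 'p padic) < 1" by simp
    hence "?p dvd a" by (simp add: padic_abs_of_int_less_1_iff)
    thus False using b ab(3) p by (meson not_prime_unit coprime_common_divisor)
  qed
  hence cop: "coprime b ?p" using p prime_imp_coprime coprime_commute by blast
  hence "\<exists>x. [b * x = 1] (mod ?p)" by (simp add: cong_solve_coprime_int)
  then obtain x where x: "[b * x = 1] (mod ?p)" ..
  define r where "r = nat ((a * x) mod ?p)"
  have ppos: "?p > 0" using p prime_gt_0_int by blast
  have ri: "int r = (a * x) mod ?p" using ppos by (simp add: r_def)
  have "[int r * b = a * x * b] (mod ?p)" unfolding ri by (simp add: cong_def mod_mult_left_eq)
  also have "a * x * b = a * (b * x)" by simp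
  also have "[a * (b * x) = a * 1] (mod ?p)" by (intro cong_mult cong_refl x)
  finally have "[a = int r * b] (mod ?p)" by (simp add: cong_sym_eq)
  hence "?p dvd a - int r * b" by (simp add: cong_iff_dvd_diff)
  hence "padic_abs (of_int (a - int r * b) :: 'p padic) < 1" by (simp only: padic_abs_of_int_less_1_iff)
  moreover have "of_int (a - int r * b) = (of_rat q - of_nat r) * (of_int b :: 'p padic)"
    using qb by (simp add: algebra_simps)
  moreover have "padic_abs (of_int b :: 'p padic) = 1"
    using nb padic_abs_of_int_less_1_iff[of b, where 'p = 'p] padic_abs_of_int_le_1[of b, where 'p = 'p]
    by (metis order_le_less)
  ultimately have "padic_abs (of_rat q - of_nat r :: 'p padic) < 1" by (simp add: padic_abs_mult)
  hence 1: "padic_abs (u - of_nat r) < 1"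
    using q padic_abs_ultra[of "u - of_rat q" "of_rat q - of_nat r"] by simp
  have 2: "r < CARD('p)" using ri ppos by (metis of_nat_less_iff pos_mod_bound)
  have 3: "s = r" if "s < CARD('p)" "padic_abs (u - of_nat s) < 1" for s
  proof -
    have "padic_abs ((u - of_nat s) - (u - of_nat r)) < 1"
      using 1 that padic_abs_ultra_diff[of "u - of_nat s" "u - of_nat r"] by simp
    also have "(u - of_nat s) - (u - of_nat r) = of_int (int r - int s)" by simp
    finally have "?p dvd int r - int s" by (simp only: padic_abs_of_int_less_1_iff)
    hence "int r mod ?p = int s mod ?p" by (simp add: mod_eq_dvd_iff)
    thus ?thesis using 2 that by simp
  qed
  show ?thesis using 1 2 3 by blast
qed

text \<open>Reduction modulo \<open>p\<close> of a p-adic integer, as a residue in \<open>{0..<p}\<close>.\<close>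

definition padic_residue :: "'p::prime_card padic \<Rightarrow> nat" where
  "padic_residue u = (THE r. r < CARD('p) \<and> padic_abs (u - of_nat r) < 1)"

lemma padic_residue:
  fixes u :: "'p::prime_card padic"
  assumes "padic_abs u \<le> 1"
  shows "padic_residue u < CARD('p)" "padic_abs (u - of_nat (padic_residue u)) < 1"
  using theI'[OF padic_residue_ex1[OF assms]] unfolding padic_residue_def by auto

definition padic_unit_part :: "'p::prime_card padic \<Rightarrow> 'p padic" where
  "padic_unit_part x = of_nat CARD('p) powi (- padic_ord x) * x"

text \<open>The canonical expansion \<open>x = p\<^bsup>ord x\<^esup> (d\<^sub>0 + d\<^sub>1 p + d\<^sub>2 p\<^sup>2 + \<dots>)\<close> with digits \<open>d\<^sub>j\<close>.\<close>

definition padic_expansion :: "'p::prime_card padic \<Rightarrow> (nat \<Rightarrow> nat) \<Rightarrow> bool" where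
  "padic_expansion x d \<longleftrightarrow>
     (\<forall>j. d j < CARD('p)) \<and> d 0 \<noteq> 0 \<and>
     x = of_nat CARD('p) powi padic_ord x * (\<Sum>j. of_nat (d j) * of_nat CARD('p) ^ j)"

lemma padic_abs_power: "padic_abs (x ^ n :: 'p::prime_card padic) = padic_abs x ^ n"
  by (induction n) (auto simp: padic_abs_mult)

lemma padic_abs_inverse: "padic_abs (inverse x :: 'p::prime_card padic) = inverse (padic_abs x)"
proof (cases "x = 0")
  case False
  hence "padic_abs x * padic_abs (inverse x) = 1" by (simp flip: padic_abs_mult)
  thus ?thesis by (metis inverse_unique)
qed auto

lemma padic_abs_powi: "padic_abs (x powi k :: 'p::prime_card padic) = padic_abs x powi k"
  by (cases "k \<ge> 0") (auto simp: power_int_def padic_abs_power padic_abs_inverse)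

lemma padic_abs_p: "padic_abs (of_nat CARD('p) :: 'p::prime_card padic) = inverse (real CARD('p))"
proof -
  have "padic_abs (of_nat CARD('p) :: 'p padic) = rat_abs CARD('p) (of_int (int CARD('p)))"
    using padic_abs_of_rat[of "of_nat CARD('p)", where 'p = 'p] by (simp add: padic_of_rat_of_nat)
  also have "\<dots> = real CARD('p) powi (- int (multiplicity (int CARD('p)) (int CARD('p))))"
    unfolding rat_abs_def rat_ord_def by simp
  also have "multiplicity (int CARD('p)) (int CARD('p)) = 1"
    using prime_card_int[where 'a = 'p] by (intro multiplicity_prime) auto
  finally show ?thesis by (simp add: power_int_minus)
qed

lemma padic_abs_unit_part:
  fixes x :: "'p::prime_card padic"
  assumes "x \<noteq> 0" shows "padic_abs (padic_unit_part x) = 1"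
proof -
  have p: "real CARD('p) \<noteq> 0" by simp
  have "padic_abs (padic_unit_part x)
      = inverse (real CARD('p)) powi (- padic_ord x) * real CARD('p) powi (- padic_ord x)"
    unfolding padic_unit_part_def padic_abs_mult padic_abs_powi padic_abs_p
    by (simp only: padic_abs_eq_powi_ord[OF assms])
  also have "\<dots> = (inverse (real CARD('p)) * real CARD('p)) powi (- padic_ord x)"
    by (rule power_int_mult_distrib[symmetric])
  also have "\<dots> = 1" using p by simp
  finally show ?thesis .
qed

lemma padic_expansion_exists:
  fixes x :: "'p::prime_card padic"
  assumes "x \<noteq> 0" shows "\<exists>d. padic_expansion x d"
proof -
  let ?p = "of_nat CARD('p) :: 'p padic"
  have p0: "?p \<noteq> 0" by simp
  define u where "u = padic_unit_part x"
  have u: "padic_abs u = 1" using padic_abs_unit_part[OF assms] by (simp add: u_def)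
  define r where "r = rec_nat u (\<lambda>_ v. (v - of_nat (padic_residue v)) / ?p)"
  define d where "d n = padic_residue (r n)" for n
  have r0: "r 0 = u" and rS: "r (Suc n) = (r n - of_nat (d n)) / ?p" for n
    by (simp_all add: r_def d_def)
  have rle: "padic_abs (r n) \<le> 1" for n
  proof (induction n)
    case (Suc n)
    define v where "v = r n - of_nat (d n)"
    have lt: "padic_abs v < 1" using padic_residue(2)[OF Suc] by (simp add: v_def d_def)
    have pg: "1 < real CARD('p)" using prime_gt_1_nat[OF prime_card[where 'a = 'p]] by simp
    have "padic_abs v * real CARD('p) \<le> 1"
    proof (cases "v = 0")
      case False
      note e = padic_abs_eq_powi_ord[OF False]
      have "padic_ord v \<ge> 1"
      proof (rule ccontr)
        assume "\<not> padic_ord v \<ge> 1"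
        hence "real CARD('p) powi 0 \<le> real CARD('p) powi (- padic_ord v)"
          using pg by (intro power_int_increasing) auto
        thus False using lt e by simp
      qed
      hence "real CARD('p) powi (- padic_ord v) \<le> real CARD('p) powi (- 1)"
        using pg by (intro power_int_increasing) auto
      hence "padic_abs v \<le> inverse (real CARD('p))" unfolding e by (simp only: power_int_minus power_int_1_right)
      hence "padic_abs v * real CARD('p) \<le> inverse (real CARD('p)) * real CARD('p)"
        by (rule mult_right_mono) simp
      thus ?thesis by simp
    qed auto
    thus ?case unfolding rS v_def[symmetric]
      by (simp add: divide_inverse padic_abs_mult padic_abs_inverse padic_abs_p)
  qed (simp add: r0 u)
  have dlt: "d n < CARD('p)" for n using padic_residue(1)[OF rle[of n]] by (simp add: d_def)
  have d0: "d 0 \<noteq> 0"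
  proof
    assume "d 0 = 0"
    hence "padic_residue u = 0" by (simp add: d_def r0)
    thus False using padic_residue(2)[OF rle[of 0]] u by (simp add: r0)
  qed
  have part: "u = (\<Sum>j<n. of_nat (d j) * ?p ^ j) + r n * ?p ^ n" for n
  proof (induction n)
    case (Suc n)
    have "r n = of_nat (d n) + r (Suc n) * ?p" using p0 by (simp add: rS)
    thus ?case using Suc by (simp add: algebra_simps)
  qed (simp add: r0)
  have "(\<lambda>n. padic_abs (r n * ?p ^ n - 0)) \<longlonglongrightarrow> 0"
  proof (rule tendsto_sandwich[OF _ _ tendsto_const])
    have "inverse (real CARD('p)) < 1"
      using prime_gt_1_nat[OF prime_card[where 'a = 'p]] by (simp add: inverse_less_1_iff)
    thus "(\<lambda>n. inverse (real CARD('p)) ^ n) \<longlonglongrightarrow> 0"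
      by (intro LIMSEQ_realpow_zero) auto
    show "\<forall>\<^sub>F n in sequentially. padic_abs (r n * ?p ^ n - 0) \<le> inverse (real CARD('p)) ^ n"
      unfolding diff_zero padic_abs_mult padic_abs_power padic_abs_p
      by (intro always_eventually allI mult_left_le_one_le) (auto simp: rle)
  qed auto
  hence "(\<lambda>n. r n * ?p ^ n) \<longlonglongrightarrow> 0" by (simp only: padic_LIMSEQ_iff)
  hence "(\<lambda>n. u - r n * ?p ^ n) \<longlonglongrightarrow> u - 0" by (intro tendsto_diff tendsto_const)
  moreover have "u - r n * ?p ^ n = (\<Sum>j<n. of_nat (d j) * ?p ^ j)" for n
    using part[of n] by (simp add: algebra_simps)
  ultimately have "(\<lambda>j. of_nat (d j) * ?p ^ j) sums u" by (simp add: sums_def)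
  hence s: "(\<Sum>j. of_nat (d j) * ?p ^ j) = u" by (rule sums_unique[symmetric])
  have "x = ?p powi padic_ord x * u"
    using p0 by (simp add: u_def padic_unit_part_def power_int_minus)
  thus ?thesis using dlt d0 s unfolding padic_expansion_def by metis
qed


section \<open>The hard-core model on the Cayley tree\<close>

text \<open>
  A vertex is the list of choices made on the path from the root, latest choice first, so that its
  distance from the root is its length. The root has \<open>k + 1\<close> successors, every other vertex \<open>k\<close>.
\<close>

definition successors :: "nat \<Rightarrow> nat list \<Rightarrow> nat list set" where
  "successors k x = {i # x | i. i < (if x = [] then k + 1 else k)}"

inductive_set cayley_tree :: "nat \<Rightarrow> nat list set" for k where
  root: "[] \<in> cayley_tree k"
| succ: "x \<in> cayley_tree k \<Longrightarrow> y \<in> successors k x \<Longrightarrow> y \<in> cayley_tree k"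

text \<open>
  The compatibility equation for a function \<open>z\<close> from vertices to sequences; it determines a
  generalized p-adic Gibbs measure. The sequence index runs over the nonzero spin values, the
  summand \<open>1\<close> being the contribution of spin \<open>0\<close>.
\<close>

definition compatible ::
  "nat \<Rightarrow> (nat \<Rightarrow> 'p::prime_card padic) \<Rightarrow> (nat list \<Rightarrow> nat \<Rightarrow> 'p padic) \<Rightarrow> bool" where
  "compatible k lam z \<longleftrightarrow>
     (\<forall>x \<in> cayley_tree k - {[]}.
        (\<forall>y \<in> successors k x. summable (z y) \<and> 1 + (\<Sum>j. z y j) \<noteq> 0) \<and>
        (\<forall>i. z x i = lam i * (\<Prod>y\<in>successors k x. inverse (1 + (\<Sum>j. z y j)))))"

definition two_periodic :: "nat \<Rightarrow> (nat list \<Rightarrow> 'b) \<Rightarrow> bool" where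
  "two_periodic k z \<longleftrightarrow>
     (\<forall>x \<in> cayley_tree k. \<forall>y \<in> cayley_tree k. even (length x) = even (length y) \<longrightarrow> z x = z y) \<and>
     (\<exists>x \<in> cayley_tree k. \<exists>y \<in> cayley_tree k. z x \<noteq> z y)"

definition periodic_GpGM ::
  "nat \<Rightarrow> (nat \<Rightarrow> 'p::prime_card padic) \<Rightarrow> (nat list \<Rightarrow> nat \<Rightarrow> 'p padic) set" where
  "periodic_GpGM k lam = {z \<in> extensional (cayley_tree k). compatible k lam z \<and> two_periodic k z}"

definition ecard :: "'a set \<Rightarrow> enat" where
  "ecard A = (if finite A then enat (card A) else \<infinity>)"

definition N_PGpGM :: "nat \<Rightarrow> (nat \<Rightarrow> 'p::prime_card padic) \<Rightarrow> enat" where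
  "N_PGpGM k lam = ecard (periodic_GpGM k lam)"

text \<open>For \<open>k = 2\<close>, this is the number of points of period exactly two of the following map on \<open>c\<^sub>0\<close>.\<close>

definition hc_map :: "(nat \<Rightarrow> 'p::prime_card padic) \<Rightarrow> (nat \<Rightarrow> 'p padic) \<Rightarrow> nat \<Rightarrow> 'p padic" where
  "hc_map lam z n = lam n / (1 + (\<Sum>m. z m)) ^ 2"

definition hc_period_two :: "(nat \<Rightarrow> 'p::prime_card padic) \<Rightarrow> (nat \<Rightarrow> 'p padic) set" where
  "hc_period_two lam =
     {z. z \<longlonglongrightarrow> 0 \<and> (\<Sum>m. z m) \<noteq> - 1 \<and> (\<Sum>m. hc_map lam z m) \<noteq> - 1 \<and>
         hc_map lam (hc_map lam z) = z \<and> hc_map lam z \<noteq> z}"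

lemma successors_2: "x \<noteq> [] \<Longrightarrow> successors 2 x = {0 # x, 1 # x}"
  by (auto simp: successors_def less_2_cases_iff)

lemma prod_successors_2:
  fixes f :: "nat list \<Rightarrow> 'a::comm_monoid_mult"
  shows "x \<noteq> [] \<Longrightarrow> (\<Prod>y\<in>successors 2 x. f y) = f (0 # x) * f (1 # x)"
  by (simp add: successors_2)

lemma padic_one_plus_eq_0_iff: "1 + s = (0 :: 'p::prime_card padic) \<longleftrightarrow> s = - 1"
  by (metis add.commute eq_neg_iff_add_eq_0)

lemma hc_map_tendsto_0:
  assumes "lam \<longlonglongrightarrow> (0 :: 'p::prime_card padic)" shows "hc_map lam z \<longlonglongrightarrow> 0"
proof -
  define c where "c = inverse ((1 + (\<Sum>m. z m)) ^ 2)"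
  have "hc_map lam z = (\<lambda>n. lam n * c)" by (simp add: hc_map_def c_def divide_inverse fun_eq_iff)
  moreover have "(\<lambda>n. lam n * c) \<longlonglongrightarrow> 0 * c" by (intro tendsto_mult assms tendsto_const)
  ultimately show ?thesis by simp
qed

lemma periodic_GpGM_2D:
  fixes w :: "nat list \<Rightarrow> nat \<Rightarrow> 'p::prime_card padic"
  assumes "w \<in> periodic_GpGM 2 lam"
  shows "w [] \<in> hc_period_two lam"
    and "w = (\<lambda>x\<in>cayley_tree 2. if even (length x) then w [] else hc_map lam (w []))"
proof -
  have ext: "w \<in> extensional (cayley_tree 2)" and comp: "compatible 2 lam w"
    and per: "two_periodic 2 w" using assms by (auto simp: periodic_GpGM_def)
  have T0: "[] \<in> cayley_tree 2" by (rule cayley_tree.root)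
  have T1: "[0] \<in> cayley_tree 2" by (rule cayley_tree.succ[OF T0]) (simp add: successors_def)
  have T2: "[0, 0] \<in> cayley_tree 2" "[1, 0] \<in> cayley_tree 2"
    by (rule cayley_tree.succ[OF T1], simp add: successors_def)+
  have T3: "[0, 0, 0] \<in> cayley_tree 2" "[1, 0, 0] \<in> cayley_tree 2"
    by (rule cayley_tree.succ[OF T2(1)], simp add: successors_def)+
  define a b where "a = w []" and "b = w [0]"
  have same: "w x = w y" if "x \<in> cayley_tree 2" "y \<in> cayley_tree 2" "even (length x) = even (length y)" for x y
    using per that unfolding two_periodic_def by blast
  have ev: "w x = a" if "x \<in> cayley_tree 2" "even (length x)" for x
    unfolding a_def by (rule same) (use that T0 in auto)
  have od: "w x = b" if "x \<in> cayley_tree 2" "odd (length x)" for x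
    unfolding b_def by (rule same) (use that T1 in auto)
  have w2: "w [0, 0] = a" "w [1, 0] = a" using T2 by (auto intro: ev)
  have w3: "w [0, 0, 0] = b" "w [1, 0, 0] = b" using T3 by (auto intro: od)
  have C: "(\<forall>y \<in> successors 2 x. summable (w y) \<and> 1 + (\<Sum>j. w y j) \<noteq> 0) \<and>
      (\<forall>i. w x i = lam i * (inverse (1 + (\<Sum>j. w (0 # x) j)) * inverse (1 + (\<Sum>j. w (1 # x) j))))"
    if "x \<in> cayley_tree 2" "x \<noteq> []" for x
    using comp that unfolding compatible_def by (simp add: prod_successors_2)
  have 1: "summable a" "1 + (\<Sum>j. a j) \<noteq> 0" "b = hc_map lam a"
    using C[OF T1] w2 by (auto simp: successors_2 b_def[symmetric] hc_map_def divide_inverse power2_eq_square)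
  have 2: "1 + (\<Sum>j. b j) \<noteq> 0" "a = hc_map lam b"
    using C[OF T2(1)] w2 w3 by (auto simp: successors_2 hc_map_def divide_inverse power2_eq_square)
  obtain x y where xy: "x \<in> cayley_tree 2" "y \<in> cayley_tree 2" "w x \<noteq> w y"
    using per unfolding two_periodic_def by blast
  have "a \<noteq> b"
    using xy ev[of x] ev[of y] od[of x] od[of y] by (cases "even (length x)"; cases "even (length y)") simp_all
  hence "hc_map lam a \<noteq> a" "hc_map lam (hc_map lam a) = a" "(\<Sum>j. hc_map lam a j) \<noteq> - 1"
    unfolding 1(3)[symmetric] using 2(1) 2(2)[symmetric] padic_one_plus_eq_0_iff by blast+
  moreover have "a \<longlonglongrightarrow> 0" "(\<Sum>j. a j) \<noteq> - 1"
    using 1(1,2) padic_summable_iff padic_one_plus_eq_0_iff by blast+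
  ultimately show "w [] \<in> hc_period_two lam"
    unfolding a_def[symmetric] hc_period_two_def by blast
  show "w = (\<lambda>x\<in>cayley_tree 2. if even (length x) then w [] else hc_map lam (w []))"
    unfolding a_def[symmetric] 1(3)[symmetric]
    by (rule extensionalityI[OF ext restrict_extensional]) (auto simp: ev od)
qed

lemma periodic_GpGM_2I:
  fixes z :: "nat \<Rightarrow> 'p::prime_card padic"
  assumes lam: "lam \<longlonglongrightarrow> 0" and z: "z \<in> hc_period_two lam"
  shows "(\<lambda>x\<in>cayley_tree 2. if even (length x) then z else hc_map lam z) \<in> periodic_GpGM 2 lam"
    (is "?w \<in> _")
proof -
  have zD: "z \<longlonglongrightarrow> 0" "1 + (\<Sum>m. z m) \<noteq> 0" "1 + (\<Sum>m. hc_map lam z m) \<noteq> 0"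
    "hc_map lam (hc_map lam z) = z" "hc_map lam z \<noteq> z"
    using z by (auto simp: hc_period_two_def padic_one_plus_eq_0_iff)
  have sum: "summable z" "summable (hc_map lam z)"
    using zD(1) hc_map_tendsto_0[OF lam] by (auto simp: padic_summable_iff)
  have val: "?w x = (if even (length x) then z else hc_map lam z)" if "x \<in> cayley_tree 2" for x
    using that by simp
  have T0: "[] \<in> cayley_tree 2" by (rule cayley_tree.root)
  have T1: "[0] \<in> cayley_tree 2" by (rule cayley_tree.succ[OF T0]) (simp add: successors_def)
  have "compatible 2 lam ?w"
    unfolding compatible_def
  proof (intro ballI)
    fix x assume x: "x \<in> cayley_tree 2 - {[]}"
    hence T: "y \<in> cayley_tree 2" if "y \<in> successors 2 x" for y
      using that cayley_tree.succ by auto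
    have y: "?w y = (if even (length x) then hc_map lam z else z)" if "y \<in> successors 2 x" for y
      using val[OF T[OF that]] that by (auto simp: successors_def)
    have s: "0 # x \<in> successors 2 x" "1 # x \<in> successors 2 x" using x by (auto simp: successors_2)
    have P: "(\<Prod>y\<in>successors 2 x. inverse (1 + (\<Sum>j. ?w y j))) =
        inverse (1 + (\<Sum>j. (if even (length x) then hc_map lam z else z) j)) ^ 2"
    proof -
      have "x \<noteq> []" using x by auto
      show ?thesis
        unfolding prod_successors_2[OF \<open>x \<noteq> []\<close>] y[OF s(1)] y[OF s(2)] power2_eq_square ..
    qed
    have v: "?w x i = lam i * inverse (1 + (\<Sum>j. (if even (length x) then hc_map lam z else z) j)) ^ 2" for i
    proof (cases "even (length x)")
      case True
      have "?w x i = hc_map lam (hc_map lam z) i" using True x val[of x] zD(4) by simp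
      thus ?thesis using True by (simp add: hc_map_def[of lam "hc_map lam z"] divide_inverse power_inverse)
    next
      case False
      have "?w x i = hc_map lam z i" using False x val[of x] by simp
      thus ?thesis using False by (simp add: hc_map_def divide_inverse power_inverse)
    qed
    show "(\<forall>y\<in>successors 2 x. summable (?w y) \<and> 1 + (\<Sum>j. ?w y j) \<noteq> 0) \<and>
        (\<forall>i. ?w x i = lam i * (\<Prod>y\<in>successors 2 x. inverse (1 + (\<Sum>j. ?w y j))))"
    proof (intro conjI ballI allI)
      fix y' assume y': "y' \<in> successors 2 x"
      show "summable (?w y')" "1 + (\<Sum>j. ?w y' j) \<noteq> 0" unfolding y[OF y'] using sum zD by auto
    next
      fix i
      show "?w x i = lam i * (\<Prod>y\<in>successors 2 x. inverse (1 + (\<Sum>j. ?w y j)))"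
        unfolding P by (rule v)
    qed
  qed
  moreover have "two_periodic 2 ?w"
    unfolding two_periodic_def
  proof (intro conjI ballI impI)
    fix x y assume "x \<in> cayley_tree 2" "y \<in> cayley_tree 2" "even (length x) = even (length y)"
    thus "?w x = ?w y" by simp
  next
    have "?w [] \<noteq> ?w [0]" using T0 T1 zD(5) by simp
    thus "\<exists>x\<in>cayley_tree 2. \<exists>y\<in>cayley_tree 2. ?w x \<noteq> ?w y" using T0 T1 by blast
  qed
  ultimately show ?thesis by (simp add: periodic_GpGM_def)
qed

lemma N_PGpGM_2_eq:
  fixes lam :: "nat \<Rightarrow> 'p::prime_card padic"
  assumes "lam \<longlonglongrightarrow> 0"
  shows "N_PGpGM 2 lam = ecard (hc_period_two lam)"
proof -
  have "bij_betw (\<lambda>w. w []) (periodic_GpGM 2 lam) (hc_period_two lam)"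
  proof (rule bij_betw_byWitness
      [where f' = "\<lambda>z. \<lambda>x\<in>cayley_tree 2. if even (length x) then z else hc_map lam z"])
    show "\<forall>w\<in>periodic_GpGM 2 lam.
        (\<lambda>x\<in>cayley_tree 2. if even (length x) then w [] else hc_map lam (w [])) = w"
      using periodic_GpGM_2D(2)[of _ lam] by (intro ballI) (rule sym)
    show "\<forall>z\<in>hc_period_two lam.
        (\<lambda>x\<in>cayley_tree 2. if even (length x) then z else hc_map lam z) [] = z"
      by (simp add: cayley_tree.root)
    show "(\<lambda>w. w []) ` periodic_GpGM 2 lam \<subseteq> hc_period_two lam"
      using periodic_GpGM_2D(1) by blast
    show "(\<lambda>z. \<lambda>x\<in>cayley_tree 2. if even (length x) then z else hc_map lam z) ` hc_period_two lam
        \<subseteq> periodic_GpGM 2 lam"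
      using periodic_GpGM_2I[OF assms] by blast
  qed
  hence "finite (periodic_GpGM 2 lam) = finite (hc_period_two lam)"
    "card (periodic_GpGM 2 lam) = card (hc_period_two lam)"
    by (rule bij_betw_finite, rule bij_betw_same_card)
  thus ?thesis unfolding N_PGpGM_def ecard_def by (simp only:)
qed

end

(* A point z of period two is determined by s = sum z, because z = lam / (1 + t)^2 with
   t = theta / (1 + s)^2. Put x = 1 + s and y = 1 + t. Then (y - 1) x^2 = theta = (x - 1) y^2, and
   subtracting and cancelling x - y gives x + y = x y = theta. So the count is the number of roots
   of X^2 - theta X + theta, which is 2 or 0 according to whether the discriminant
   theta (theta - 4) is a square. For odd p, being a square is stable under perturbations of
   relative size less than 1, which reduces the discriminant to theta^2, to -4 theta, to the
   integer d_0^2 - 4 d_0 and to 4 (theta - 4) in the respective cases. *)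
theory Submission
  imports Defs
begin

section \<open>Squares in the p-adic numbers\<close>

lemma square_mult_left_iff:
  fixes q v :: "'a::field"
  assumes q: "q \<noteq> 0"
  shows "(\<exists>y. y\<^sup>2 = q\<^sup>2 * v) \<longleftrightarrow> (\<exists>y. y\<^sup>2 = v)"
proof
  assume "\<exists>y. y\<^sup>2 = q\<^sup>2 * v"
  then obtain y where "y\<^sup>2 = q\<^sup>2 * v" ..
  hence "(y / q)\<^sup>2 = v" using q by (simp add: power_divide)
  thus "\<exists>y. y\<^sup>2 = v" ..
next
  assume "\<exists>y. y\<^sup>2 = v"
  then obtain y where "y\<^sup>2 = v" ..
  hence "(q * y)\<^sup>2 = q\<^sup>2 * v" by (simp add: power_mult_distrib)
  thus "\<exists>y. y\<^sup>2 = q\<^sup>2 * v" ..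
qed

text \<open>An odd prime does not divide 2, so 2 is a unit. Every use of p >= 3 comes down to this
  fact.\<close>

lemma padic_abs_2:
  assumes "CARD('p::prime_card) \<ge> 3"
  shows "padic_abs (2 :: 'p padic) = 1"
proof -
  have "\<not> int CARD('p) dvd 2"
    using assms by (auto dest: zdvd_imp_le)
  hence "\<not> padic_abs (of_int 2 :: 'p padic) < 1"
    by (simp only: padic_abs_of_int_less_1_iff not_False_eq_True)
  with padic_abs_of_int_le_1[of 2, where 'p = 'p] show ?thesis by simp
qed

text \<open>A Hensel-type argument by contraction: 1 + y is a root of u exactly when y = (u - 1 -
  y^2) / 2. The right-hand side maps the closed ball of radius c = |u - 1| around 0 into itself and
  contracts it, because |2| = 1. The number c is both the radius and the contraction
  constant.\<close>

lemma padic_square_near_1: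
  fixes u :: "'p::prime_card padic"
  assumes p: "CARD('p) \<ge> 3" and u: "padic_abs (u - 1) < 1"
  shows "\<exists>y. y\<^sup>2 = u"
proof -
  define c where "c = padic_abs (u - 1)"
  define f where "f y = (u - 1 - y\<^sup>2) / 2" for y :: "'p padic"
  define B where "B = cball (0 :: 'p padic) c"
  have c: "0 \<le> c" "c < 1" using u by (auto simp: c_def)
  have half: "padic_abs (x / 2) = padic_abs x" for x :: "'p padic"
    by (simp only: divide_inverse padic_abs_mult padic_abs_inverse padic_abs_2[OF p]
        inverse_1 mult_1_right)
  have B: "y \<in> B \<longleftrightarrow> padic_abs y \<le> c" for y
    by (simp add: B_def dist_padic_def)
  have "\<exists>!y\<in>B. f y = y"
  proof (rule Banach_fix[OF _ _ c])
    show "complete B" by (simp add: B_def complete_eq_closed)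
    show "B \<noteq> {}" using c B[of 0] by auto
    show "f ` B \<subseteq> B"
    proof (rule image_subsetI)
      fix y assume "y \<in> B"
      \<comment> \<open>One factor is bounded by c, the other only by 1; the product then stays
        within the radius.\<close>
      hence "padic_abs y * padic_abs y \<le> c * 1"
        using c by (intro mult_mono) (auto simp: B)
      hence "padic_abs (y\<^sup>2) \<le> c" by (simp add: padic_abs_mult power2_eq_square)
      thus "f y \<in> B"
        using padic_abs_ultra_diff[of "u - 1" "y\<^sup>2"] by (simp add: B f_def half c_def)
    qed
    fix x y assume xy: "x \<in> B" "y \<in> B"
    have "(u - 1 - x\<^sup>2) - (u - 1 - y\<^sup>2) = (y + x) * (y - x)"
      by (simp add: power2_eq_square algebra_simps)
    hence "f x - f y = (y + x) * (y - x) / 2"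
      unfolding f_def diff_divide_distrib[symmetric] by (rule arg_cong)
    hence "dist (f x) (f y) = padic_abs (y + x) * padic_abs (x - y)"
      by (simp only: dist_padic_def half padic_abs_mult padic_abs_minus_commute[of x y])
    also have "\<dots> \<le> c * padic_abs (x - y)"
      using xy padic_abs_ultra[of y x] by (intro mult_right_mono) (auto simp: B)
    finally show "dist (f x) (f y) \<le> c * dist x y" by (simp add: dist_padic_def)
  qed
  then obtain y where "f y = y" by blast
  hence "u - 1 - y\<^sup>2 = y * 2" by (simp add: f_def field_simps)
  hence "(1 + y)\<^sup>2 = u" by (simp add: power2_eq_square algebra_simps)
  thus ?thesis ..
qed

text \<open>The hypothesis puts u / v at distance less than 1 from 1, so u / v is a square and u
  differs from v by a nonzero square factor. Each case of the theorem simplifies the discriminant in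
  this way.\<close>

lemma padic_square_perturb:
  fixes u v :: "'p::prime_card padic"
  assumes p: "CARD('p) \<ge> 3" and uv: "padic_abs (u - v) < padic_abs v"
  shows "(\<exists>y. y\<^sup>2 = u) \<longleftrightarrow> (\<exists>y. y\<^sup>2 = v)"
proof -
  have v: "v \<noteq> 0" using uv padic_abs_nonneg[of "u - v"] by (metis not_less padic_abs_0)
  have "u / v - 1 = (u - v) * inverse v" using v by (simp add: field_simps)
  hence "padic_abs (u / v - 1) = padic_abs (u - v) / padic_abs v"
    by (simp only: padic_abs_mult padic_abs_inverse divide_inverse)
  hence "padic_abs (u / v - 1) < 1"
    using uv le_less_trans[OF padic_abs_nonneg uv] by (simp add: divide_less_eq)
  then obtain r where r: "r\<^sup>2 = u / v" using padic_square_near_1[OF p] by blast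
  \<comment> \<open>For u = 0 the two sides of \<open>uv\<close> would be equal.\<close>
  have "u \<noteq> 0" using uv by auto
  hence "r \<noteq> 0" using r v by auto
  have ur: "u = r\<^sup>2 * v" using r v by simp
  show ?thesis unfolding ur by (rule square_mult_left_iff[OF \<open>r \<noteq> 0\<close>])
qed

text \<open>A p-adic root of a unit is a unit, and its residue r is a root modulo p since y^2 - r^2
  = (y + r) (y - r) is small. Conversely, a root x modulo p makes the square x^2 a small
  perturbation of a.\<close>

lemma padic_square_of_int_iff:
  assumes p: "CARD('p::prime_card) \<ge> 3" and a: "\<not> int CARD('p) dvd a"
  shows "(\<exists>y :: 'p padic. y\<^sup>2 = of_int a) \<longleftrightarrow> QuadRes (int CARD('p)) a"
proof
  have abs_a: "padic_abs (of_int a :: 'p padic) = 1"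
    using a padic_abs_of_int_less_1_iff[of a, where 'p = 'p]
      padic_abs_of_int_le_1[of a, where 'p = 'p] by linarith
  {
    assume "\<exists>y :: 'p padic. y\<^sup>2 = of_int a"
    then obtain y :: "'p padic" where y: "y\<^sup>2 = of_int a" ..
    hence "padic_abs y ^ 2 = 1" using abs_a by (simp flip: padic_abs_power)
    hence y1: "padic_abs y = 1" using padic_abs_nonneg[of y] by (simp add: power2_eq_1_iff)
    define r where "r = padic_residue y"
    have r: "padic_abs (y - of_nat r) < 1" using padic_residue(2)[of y] y1 by (simp add: r_def)
    have "padic_abs (y + of_nat r) \<le> 1"
      using padic_abs_ultra[of y "of_nat r"] y1 padic_abs_of_int_le_1[of "int r", where 'p = 'p]
      by simp
    hence "padic_abs (y + of_nat r) * padic_abs (y - of_nat r) < 1"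
      using r by (meson le_less_trans mult_left_le_one_le padic_abs_nonneg)
    hence "padic_abs (y\<^sup>2 - (of_nat r)\<^sup>2) < 1"
      by (simp add: power2_eq_square square_diff_square_factored padic_abs_mult)
    hence "padic_abs (of_int (a - (int r)\<^sup>2) :: 'p padic) < 1" by (simp add: y)
    hence "int CARD('p) dvd a - (int r)\<^sup>2" by (simp only: padic_abs_of_int_less_1_iff)
    hence "[(int r)\<^sup>2 = a] (mod int CARD('p))" by (metis cong_iff_dvd_diff cong_sym)
    thus "QuadRes (int CARD('p)) a" unfolding QuadRes_def ..
  next
    assume "QuadRes (int CARD('p)) a"
    then obtain x where "[x\<^sup>2 = a] (mod int CARD('p))" unfolding QuadRes_def ..
    hence "int CARD('p) dvd a - x\<^sup>2" by (metis cong_iff_dvd_diff cong_sym)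
    hence "padic_abs (of_int (a - x\<^sup>2) :: 'p padic) < 1" by (simp only: padic_abs_of_int_less_1_iff)
    hence "padic_abs ((of_int x)\<^sup>2 - of_int a :: 'p padic) < padic_abs (of_int a :: 'p padic)"
      by (simp add: abs_a padic_abs_minus_commute[of "(of_int x)\<^sup>2"])
    from padic_square_perturb[OF p this] show "\<exists>y :: 'p padic. y\<^sup>2 = of_int a" by blast
  }
qed

section \<open>Order, unit part and leading digit\<close>

lemma padic_unit_part_decomp:
  fixes x :: "'p::prime_card padic"
  shows "x = of_nat CARD('p) powi padic_ord x * padic_unit_part x"
  by (simp add: padic_unit_part_def power_int_minus)

lemma padic_ord_eqI:
  fixes x :: "'p::prime_card padic"
  assumes "padic_abs x = real CARD('p) powi (- k)"
  shows "padic_ord x = k"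
proof -
  have "x \<noteq> 0" using assms by auto
  hence "real CARD('p) powi (- padic_ord x) = real CARD('p) powi (- k)"
    using assms padic_abs_eq_powi_ord by metis
  moreover have "1 < real CARD('p)" using prime_gt_1_nat[OF prime_card[where 'a = 'p]] by simp
  ultimately show ?thesis
    using power_int_strict_increasing[of "- k" "- padic_ord x" "real CARD('p)"]
      power_int_strict_increasing[of "- padic_ord x" "- k" "real CARD('p)"] by force
qed

lemma padic_ord_power2:
  fixes x :: "'p::prime_card padic"
  assumes "x \<noteq> 0" shows "padic_ord (x\<^sup>2) = 2 * padic_ord x"
proof (rule padic_ord_eqI)
  have "real CARD('p) powi (- (2 * padic_ord x)) = (real CARD('p) powi (- padic_ord x)) ^ 2"
    by (simp add: power2_eq_square flip: power_int_add)
  thus "padic_abs (x\<^sup>2) = real CARD('p) powi (- (2 * padic_ord x))"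
    by (simp only: padic_abs_power padic_abs_eq_powi_ord[OF assms])
qed

lemma padic_ord_minus: "padic_ord (- x :: 'p::prime_card padic) = padic_ord x"
  by (simp add: padic_ord_def)

lemma padic_unit_part_minus:
  "padic_unit_part (- x :: 'p::prime_card padic) = - padic_unit_part x"
  by (simp add: padic_unit_part_def padic_ord_minus)

text \<open>The order of a square is even. If the order of w is 2k, then w is the square of p^k
  times its unit part, and that unit may be replaced by a nearby integer. The integer
  \<open>a\<close> is any representative of its residue class, so that both
  \<open>- int (d 0)\<close> and a value of \<open>padic_residue\<close> fit.\<close>

lemma padic_square_iff:
  fixes w :: "'p::prime_card padic"
  assumes p: "CARD('p) \<ge> 3" and w: "w \<noteq> 0" and a: "padic_abs (padic_unit_part w - of_int a) < 1"
  shows "(\<exists>y. y\<^sup>2 = w) \<longleftrightarrow> even (padic_ord w) \<and> Legendre a (int CARD('p)) = 1"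
proof (cases "even (padic_ord w)")
  case False
  have "even (padic_ord w)" if "y\<^sup>2 = w" for y
    using that w padic_ord_power2[of y] by auto
  with False show ?thesis by blast
next
  case True
  then obtain k where k: "padic_ord w = 2 * k" by (rule evenE)
  define q where "q = (of_nat CARD('p) :: 'p padic) powi k"
  have q0: "q \<noteq> 0" by (simp add: q_def)
  have "q\<^sup>2 = of_nat CARD('p) powi (k + k)"
    unfolding q_def power2_eq_square by (rule power_int_add[symmetric]) simp
  hence q2: "q\<^sup>2 = of_nat CARD('p) powi padic_ord w" by (simp only: k mult_2)
  have wq: "w = q\<^sup>2 * padic_unit_part w"
    unfolding q2 by (rule padic_unit_part_decomp)
  have abs_a: "padic_abs (of_int a :: 'p padic) = 1"
    using padic_abs_dominant[of "padic_unit_part w" "of_int a"] a padic_abs_unit_part[OF w] by simp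
  have na: "\<not> int CARD('p) dvd a"
    using abs_a padic_abs_of_int_less_1_iff[of a, where 'p = 'p] by simp
  have "(\<exists>y. y\<^sup>2 = w) \<longleftrightarrow> (\<exists>y. y\<^sup>2 = q\<^sup>2 * padic_unit_part w)"
    by (simp only: wq[symmetric])
  also have "\<dots> \<longleftrightarrow> (\<exists>y. y\<^sup>2 = padic_unit_part w)"
    by (rule square_mult_left_iff[OF q0])
  also have "\<dots> \<longleftrightarrow> (\<exists>y :: 'p padic. y\<^sup>2 = of_int a)"
    using a abs_a by (intro padic_square_perturb[OF p]) simp
  also have "\<dots> \<longleftrightarrow> QuadRes (int CARD('p)) a"
    using na by (rule padic_square_of_int_iff[OF p])
  also have "\<dots> \<longleftrightarrow> Legendre a (int CARD('p)) = 1"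
    using na by (simp add: Legendre_def cong_0_iff)
  finally show ?thesis using True by simp
qed

text \<open>The digit series sums to the unit part, and all its terms of index at least 1 have
  absolute value below 1. By the ultrametric inequality so has any finite sum of them, and a partial
  sum close to the limit suffices.\<close>

lemma padic_expansion_unit_part:
  fixes x :: "'p::prime_card padic"
  assumes "padic_expansion x d"
  shows "padic_abs (padic_unit_part x - of_nat (d 0)) < 1"
proof -
  define f where "f j = (of_nat (d j) * of_nat CARD('p) ^ j :: 'p padic)" for j
  have pinv: "inverse (real CARD('p)) < 1"
    using prime_gt_1_nat[OF prime_card[where 'a = 'p]] by (simp add: inverse_less_1_iff)
  have f_le: "padic_abs (f j) \<le> inverse (real CARD('p)) ^ j" for j
    using padic_abs_of_int_le_1[of "int (d j)", where 'p = 'p]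
    unfolding f_def padic_abs_mult padic_abs_power padic_abs_p
    by (intro mult_left_le_one_le) auto
  have "f \<longlonglongrightarrow> 0" unfolding padic_LIMSEQ_iff diff_zero
  proof (rule tendsto_sandwich[OF _ _ tendsto_const])
    show "(\<lambda>j. inverse (real CARD('p)) ^ j) \<longlonglongrightarrow> 0"
      using pinv by (intro LIMSEQ_realpow_zero) auto
  qed (use f_le in auto)
  hence "(\<lambda>n. \<Sum>j<n. f j) \<longlonglongrightarrow> suminf f"
    by (simp add: padic_summable_iff summable_LIMSEQ)
  moreover have "suminf f = padic_unit_part x"
  proof -
    have "x = of_nat CARD('p) powi padic_ord x * suminf f"
      using assms unfolding padic_expansion_def f_def by blast
    thus ?thesis by (simp add: padic_unit_part_def power_int_minus field_simps)
  qed
  ultimately have "(\<lambda>n. padic_abs ((\<Sum>j<n. f j) - padic_unit_part x)) \<longlonglongrightarrow> 0"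
    by (simp add: padic_LIMSEQ_iff)
  hence "\<forall>\<^sub>F n in sequentially. padic_abs ((\<Sum>j<n. f j) - padic_unit_part x) < 1"
    by (rule order_tendstoD) simp
  \<comment> \<open>The bound n >= 1 ensures that the partial sum contains the leading
    digit.\<close>
  then obtain n where n: "padic_abs ((\<Sum>j<n. f j) - padic_unit_part x) < 1" "n \<ge> 1"
    using eventually_happens[OF eventually_conj[OF _ eventually_ge_at_top[of 1]]] by force
  have "{..<n} = insert 0 {1..<n}" using n(2) by auto
  hence "(\<Sum>j<n. f j) - of_nat (d 0) = (\<Sum>j=1..<n. f j)" by (simp add: f_def)
  moreover have "padic_abs (\<Sum>j=1..<n. f j) < 1"
  proof (rule padic_abs_sum_less)
    fix j assume "j \<in> {1..<n}"
    hence "inverse (real CARD('p)) ^ j < 1" using pinv by (simp add: power_less_one_iff)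
    thus "padic_abs (f j) < 1" using f_le[of j] by linarith
  qed simp
  ultimately show ?thesis
    using n(1) padic_abs_ultra_diff[of "(\<Sum>j<n. f j) - of_nat (d 0)" "(\<Sum>j<n. f j) - padic_unit_part x"]
    by (simp add: algebra_simps)
qed

section \<open>Period-two points and the quadratic equation\<close>

text \<open>For c = 0 both sides vanish by the convention on division, so \<open>sum_map\<close>
  below can be stated for every z.\<close>

lemma padic_sums_divide:
  fixes lam :: "nat \<Rightarrow> 'p::prime_card padic"
  assumes "lam \<longlonglongrightarrow> 0"
  shows "(\<lambda>n. lam n / c) sums ((\<Sum>n. lam n) / c)"
proof -
  have "(\<lambda>n. \<Sum>i<n. lam i) \<longlonglongrightarrow> (\<Sum>n. lam n)"
    using assms by (simp add: padic_summable_iff summable_LIMSEQ)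
  hence "(\<lambda>n. (\<Sum>i<n. lam i) * inverse c) \<longlonglongrightarrow> (\<Sum>n. lam n) * inverse c"
    by (intro tendsto_mult tendsto_const)
  thus ?thesis by (simp add: sums_def divide_inverse sum_distrib_right)
qed

text \<open>The left-hand sides differ by (x - y) (x y - (x + y)), so x y = x + y when x and y are
  distinct. Under this relation (y - 1) x^2 = x (x + y) - x^2 = x y, and likewise with x and y
  exchanged, so the common value is \<open>\<theta>\<close>.\<close>

lemma period_two_system_iff:
  fixes x y \<theta> :: "'a::field"
  assumes "\<theta> \<noteq> 0" "x \<noteq> y"
  shows "(y - 1) * x\<^sup>2 = \<theta> \<and> (x - 1) * y\<^sup>2 = \<theta> \<longleftrightarrow> x + y = \<theta> \<and> x * y = \<theta>"
proof
  assume *: "(y - 1) * x\<^sup>2 = \<theta> \<and> (x - 1) * y\<^sup>2 = \<theta>"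
  have "(x - y) * (x * y - (x + y)) = (y - 1) * x\<^sup>2 - (x - 1) * y\<^sup>2"
    by (simp add: power2_eq_square algebra_simps)
  hence e: "x * y = x + y" using * assms by simp
  have "(y - 1) * x\<^sup>2 = x * (x * y) - x * x" by (simp add: power2_eq_square algebra_simps)
  also have "\<dots> = x * y" unfolding e by (simp add: e algebra_simps)
  finally show "x + y = \<theta> \<and> x * y = \<theta>" using * e by simp
next
  assume *: "x + y = \<theta> \<and> x * y = \<theta>"
  have "(y - 1) * x\<^sup>2 = x * (x * y) - x * x" "(x - 1) * y\<^sup>2 = y * (x * y) - y * y"
    by (simp_all add: power2_eq_square algebra_simps)
  moreover have "x * (x + y) - x * x = x * y" "y * (x + y) - y * y = x * y"
    by (simp_all add: algebra_simps)
  ultimately show "(y - 1) * x\<^sup>2 = \<theta> \<and> (x - 1) * y\<^sup>2 = \<theta>" using * by metis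
qed

text \<open>That \<open>\<theta>\<close> is not 0 keeps both roots, which are the denominators, away
  from 0; that it is not 4 keeps the roots distinct, so that the point built from a root is not
  fixed.\<close>

lemma hc_period_two_bij:
  fixes lam :: "nat \<Rightarrow> 'p::prime_card padic"
  assumes lam: "lam \<longlonglongrightarrow> 0" and \<theta>: "\<theta> = (\<Sum>n. lam n)" "\<theta> \<noteq> 0" "\<theta> \<noteq> 4"
  shows "bij_betw (\<lambda>z. 1 + (\<Sum>n. z n)) (hc_period_two lam) {x. x\<^sup>2 - \<theta> * x + \<theta> = 0}"
\<comment> \<open>The other root \<open>\<theta>\<close> - x is the denominator y belonging to the
  image of z, and z is recovered as the image of that image.\<close>
proof (rule bij_betw_byWitness[where f' = "\<lambda>x n. lam n / (\<theta> - x)\<^sup>2"])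
  have sum_map: "suminf (hc_map lam z) = \<theta> / (1 + suminf z)\<^sup>2" for z
    using sums_unique[OF padic_sums_divide[OF lam]] \<theta> by (simp add: hc_map_def[abs_def])
  have to_root: "y = \<theta> - x" "x * y = \<theta>" "z = (\<lambda>n. lam n / y\<^sup>2)"
    if z: "z \<in> hc_period_two lam" and x: "x = 1 + suminf z" and y: "y = 1 + suminf (hc_map lam z)"
    for z x y
  proof -
    have nz: "x \<noteq> 0" "y \<noteq> 0" and zz: "hc_map lam (hc_map lam z) = z" "hc_map lam z \<noteq> z"
      using z by (auto simp: hc_period_two_def x y padic_one_plus_eq_0_iff)
    show zy: "z = (\<lambda>n. lam n / y\<^sup>2)"
      using zz(1) by (simp add: hc_map_def[of lam "hc_map lam z", abs_def] y)
    have zx: "hc_map lam z = (\<lambda>n. lam n / x\<^sup>2)" by (simp add: hc_map_def[abs_def] x)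
    \<comment> \<open>If x = y, then z and its image would be the same multiple of
      \<open>lam\<close>.\<close>
    have "x \<noteq> y" using zy zx zz(2) by metis
    moreover have "y - 1 = \<theta> / x\<^sup>2" using sum_map[of z] by (simp add: x y)
    moreover have "x - 1 = \<theta> / y\<^sup>2" using sum_map[of "hc_map lam z"] zz(1) by (simp add: x y)
    ultimately have "x + y = \<theta> \<and> x * y = \<theta>"
      using nz by (subst period_two_system_iff[OF \<theta>(2), symmetric]) auto
    thus "y = \<theta> - x" "x * y = \<theta>" by (auto simp: algebra_simps)
  qed
  show "\<forall>z\<in>hc_period_two lam. (\<lambda>n. lam n / (\<theta> - (1 + suminf z))\<^sup>2) = z"
    using to_root(1,3) by metis
  show "(\<lambda>z. 1 + suminf z) ` hc_period_two lam \<subseteq> {x. x\<^sup>2 - \<theta> * x + \<theta> = 0}"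
  proof safe
    fix z assume z: "z \<in> hc_period_two lam"
    define x where "x = 1 + suminf z"
    have "x * (\<theta> - x) = \<theta>" using to_root(1,2)[OF z x_def refl] by simp
    thus "(1 + suminf z)\<^sup>2 - \<theta> * (1 + suminf z) + \<theta> = 0"
      unfolding x_def[symmetric] by (simp add: power2_eq_square algebra_simps)
  qed
  have from_root: "1 + (\<Sum>n. lam n / (\<theta> - x)\<^sup>2) = x" "(\<lambda>n. lam n / (\<theta> - x)\<^sup>2) \<in> hc_period_two lam"
    if x: "x\<^sup>2 - \<theta> * x + \<theta> = 0" for x
  proof -
    define y where "y = \<theta> - x"
    define z where "z = (\<lambda>n. lam n / y\<^sup>2)"
    have xy: "x + y = \<theta>" "x * y = \<theta>" using x by (auto simp: y_def power2_eq_square algebra_simps)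
    hence nz: "x \<noteq> 0" "y \<noteq> 0" using \<theta> by auto
    \<comment> \<open>A double root gives x^2 = 2 x, hence x = 2 and \<open>\<theta>\<close> =
      4.\<close>
    have ne: "x \<noteq> y"
    proof
      assume "x = y"
      hence "x * x = 2 * x" "\<theta> = 2 * x" using xy by auto
      hence "\<theta> = 4" using nz by simp
      thus False using \<theta> by simp
    qed
    have sys: "(y - 1) * x\<^sup>2 = \<theta>" "(x - 1) * y\<^sup>2 = \<theta>"
      using period_two_system_iff[OF \<theta>(2) ne] xy by auto
    have "suminf z = \<theta> / y\<^sup>2"
      using sums_unique[OF padic_sums_divide[OF lam, of "y\<^sup>2"]] \<theta>(1) by (simp add: z_def)
    also have "\<dots> = x - 1" using sys(2) nz by (simp add: field_simps)
    finally have sz: "suminf z = x - 1" .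
    hence Fz: "hc_map lam z = (\<lambda>n. lam n / x\<^sup>2)" by (simp add: hc_map_def[abs_def])
    have "suminf (hc_map lam z) = \<theta> / x\<^sup>2" using sum_map[of z] sz by simp
    also have "\<dots> = y - 1" using sys(1) nz by (simp add: field_simps)
    finally have sFz: "suminf (hc_map lam z) = y - 1" .
    hence FFz: "hc_map lam (hc_map lam z) = z"
      unfolding hc_map_def[of lam "hc_map lam z", abs_def] by (simp add: z_def)
    \<comment> \<open>Being an image under \<open>hc_map\<close>, z is a multiple of the null
      sequence \<open>lam\<close>.\<close>
    have "z \<longlonglongrightarrow> 0" using hc_map_tendsto_0[OF lam, of "hc_map lam z"] FFz by simp
    moreover have "hc_map lam z \<noteq> z" using sz sFz ne by auto
    ultimately have "z \<in> hc_period_two lam"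
      using FFz sz sFz nz by (simp add: hc_period_two_def)
    thus "(\<lambda>n. lam n / (\<theta> - x)\<^sup>2) \<in> hc_period_two lam" "1 + (\<Sum>n. lam n / (\<theta> - x)\<^sup>2) = x"
      using sz by (simp_all add: z_def y_def)
  qed
  show "\<forall>x\<in>{x. x\<^sup>2 - \<theta> * x + \<theta> = 0}. 1 + (\<Sum>n. lam n / (\<theta> - x)\<^sup>2) = x"
    using from_root(1) by blast
  show "(\<lambda>x n. lam n / (\<theta> - x)\<^sup>2) ` {x. x\<^sup>2 - \<theta> * x + \<theta> = 0} \<subseteq> hc_period_two lam"
    using from_root(2) by blast
qed

section \<open>Roots of the quadratic and its discriminant\<close>

lemma quadratic_roots:
  fixes \<theta> e :: "'a::field_char_0"
  assumes "e\<^sup>2 = \<theta>\<^sup>2 - 4 * \<theta>"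
  shows "{x. x\<^sup>2 - \<theta> * x + \<theta> = 0} = {(\<theta> + e) / 2, (\<theta> - e) / 2}"
proof (rule Set.set_eqI)
  fix x
  have "4 * (x\<^sup>2 - \<theta> * x + \<theta>) = (2 * x - \<theta>)\<^sup>2 - (\<theta>\<^sup>2 - 4 * \<theta>)"
    by (simp add: power2_eq_square algebra_simps)
  also have "\<dots> = (2 * x - \<theta> - e) * (2 * x - \<theta> + e)"
    unfolding assms[symmetric] by (simp add: power2_eq_square algebra_simps)
  finally have "x\<^sup>2 - \<theta> * x + \<theta> = 0 \<longleftrightarrow> 2 * x - \<theta> - e = 0 \<or> 2 * x - \<theta> + e = 0"
    by (metis mult_eq_0_iff zero_neq_numeral)
  also have "\<dots> \<longleftrightarrow> x = (\<theta> + e) / 2 \<or> x = (\<theta> - e) / 2"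
    by (auto simp: field_simps)
  finally show "x \<in> {x. x\<^sup>2 - \<theta> * x + \<theta> = 0} \<longleftrightarrow> x \<in> {(\<theta> + e) / 2, (\<theta> - e) / 2}"
    by (simp only: mem_Collect_eq insert_iff empty_iff simp_thms)
qed

lemma N_PGpGM_2_discriminant:
  fixes lam :: "nat \<Rightarrow> 'p::prime_card padic"
  assumes lam: "lam \<longlonglongrightarrow> 0" and \<theta>: "\<theta> = (\<Sum>n. lam n)" "\<theta> \<noteq> 0" "\<theta> \<noteq> 4"
  shows "N_PGpGM 2 lam = (if \<exists>e. e\<^sup>2 = \<theta>\<^sup>2 - 4 * \<theta> then 2 else 0)"
proof -
  let ?R = "{x. x\<^sup>2 - \<theta> * x + \<theta> = 0}"
  note bij = hc_period_two_bij[OF assms]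
  have N: "N_PGpGM 2 lam = ecard ?R"
    unfolding N_PGpGM_2_eq[OF lam] ecard_def
    by (simp only: bij_betw_finite[OF bij] bij_betw_same_card[OF bij])
  show ?thesis
  proof (cases "\<exists>e. e\<^sup>2 = \<theta>\<^sup>2 - 4 * \<theta>")
    case True
    then obtain e where e: "e\<^sup>2 = \<theta>\<^sup>2 - 4 * \<theta>" ..
    \<comment> \<open>The discriminant is nonzero, so e is nonzero and the two roots differ.\<close>
    have "\<theta>\<^sup>2 - 4 * \<theta> = \<theta> * (\<theta> - 4)" by (simp add: power2_eq_square algebra_simps)
    hence "e \<noteq> 0" using e \<theta> by auto
    hence "(\<theta> + e) / 2 \<noteq> (\<theta> - e) / 2" by (simp add: field_simps)
    hence "ecard ?R = 2" by (simp add: quadratic_roots[OF e] ecard_def numeral_eq_enat)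
    thus ?thesis using N True by simp
  next
    case False
    \<comment> \<open>Any root x would supply 2 x - \<open>\<theta>\<close> as a square root of the
      discriminant.\<close>
    have "(2 * x - \<theta>)\<^sup>2 = \<theta>\<^sup>2 - 4 * \<theta>" if "x\<^sup>2 - \<theta> * x + \<theta> = 0" for x
    proof -
      have "(2 * x - \<theta>)\<^sup>2 = 4 * (x\<^sup>2 - \<theta> * x + \<theta>) + (\<theta>\<^sup>2 - 4 * \<theta>)"
        by (simp add: power2_eq_square algebra_simps)
      thus ?thesis using that by simp
    qed
    hence "?R = {}" using False by blast
    hence "ecard ?R = 0" by (simp add: ecard_def zero_enat_def)
    thus ?thesis using N False by simp
  qed
qed

section \<open>Case distinction on the size and residue of \<open>\<theta>\<close>\<close>

theorem theorem12:
  fixes lam :: "nat \<Rightarrow> 'p::prime_card padic" and \<theta> :: "'p padic"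
    and p :: nat and d :: "nat \<Rightarrow> nat"
  assumes p: "p = CARD('p)" "p \<ge> 3"
    and lam: "lam \<longlonglongrightarrow> 0"
    and theta: "\<theta> = (\<Sum>n. lam n)" "\<theta> \<noteq> 0" "\<theta> \<noteq> 4"
    and digits: "padic_expansion \<theta> d"
  shows
    "(padic_abs \<theta> > 1 \<longrightarrow> N_PGpGM 2 lam = 2) \<and>
     (padic_abs \<theta> < 1 \<and> even (padic_ord \<theta>) \<and> Legendre (- int (d 0)) (int p) = 1
        \<longrightarrow> N_PGpGM 2 lam = 2) \<and>
     (padic_abs \<theta> < 1 \<and> (odd (padic_ord \<theta>) \<or> Legendre (- int (d 0)) (int p) = -1)
        \<longrightarrow> N_PGpGM 2 lam = 0) \<and>
     (padic_abs \<theta> = 1 \<and> Legendre (int (d 0) ^ 2 - 4 * int (d 0)) (int p) = 1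
        \<longrightarrow> N_PGpGM 2 lam = 2) \<and>
     (padic_abs \<theta> = 1 \<and> Legendre (int (d 0) ^ 2 - 4 * int (d 0)) (int p) = -1
        \<longrightarrow> N_PGpGM 2 lam = 0) \<and>
     (padic_abs \<theta> = 1 \<and> int p dvd int (d 0) ^ 2 - 4 * int (d 0) \<and>
        even (padic_ord (\<theta> - 4)) \<and>
        Legendre (int (padic_residue (padic_unit_part (\<theta> - 4)))) (int p) = 1
        \<longrightarrow> N_PGpGM 2 lam = 2) \<and>
     (padic_abs \<theta> = 1 \<and> int p dvd int (d 0) ^ 2 - 4 * int (d 0) \<and>
        (odd (padic_ord (\<theta> - 4)) \<or>
         Legendre (int (padic_residue (padic_unit_part (\<theta> - 4)))) (int p) = -1)
        \<longrightarrow> N_PGpGM 2 lam = 0)"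
proof -
  note p3 = p(2)[unfolded p(1)]
  define D where "D = \<theta>\<^sup>2 - 4 * \<theta>"
  have N: "N_PGpGM 2 lam = (if \<exists>e. e\<^sup>2 = D then 2 else 0)"
    unfolding D_def by (rule N_PGpGM_2_discriminant[OF lam theta])
  have abs_4: "padic_abs (4 :: 'p padic) = 1"
    using padic_abs_mult[of "2 :: 'p padic" 2] padic_abs_2[OF p3] by simp
  have square_4_mult: "(\<exists>y. y\<^sup>2 = 4 * v) \<longleftrightarrow> (\<exists>y. y\<^sup>2 = v)" for v :: "'p padic"
    using square_mult_left_iff[of "2 :: 'p padic" v] by simp
  note d = padic_expansion_unit_part[OF digits]

  \<comment> \<open>Here \<open>\<theta>\<close>^2 dominates 4 \<open>\<theta>\<close>.\<close>
  have large: "\<exists>e. e\<^sup>2 = D" if "padic_abs \<theta> > 1"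
  proof -
    have "padic_abs (D - \<theta>\<^sup>2) = padic_abs \<theta>" by (simp add: D_def padic_abs_mult abs_4)
    also have "\<dots> < padic_abs (\<theta>\<^sup>2)"
      using that by (simp add: padic_abs_mult power2_eq_square)
    finally have "(\<exists>e. e\<^sup>2 = D) \<longleftrightarrow> (\<exists>e. e\<^sup>2 = \<theta>\<^sup>2)"
      by (rule padic_square_perturb[OF p3])
    thus ?thesis by auto
  qed

  \<comment> \<open>Here - 4 \<open>\<theta>\<close> dominates; the square factor 4 drops out, and
    the unit part of - \<open>\<theta>\<close> is close to - d 0.\<close>
  have small: "(\<exists>e. e\<^sup>2 = D) \<longleftrightarrow> even (padic_ord \<theta>) \<and> Legendre (- int (d 0)) (int p) = 1"
    if "padic_abs \<theta> < 1"
  proof -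
    have "padic_abs (D - 4 * (- \<theta>)) = padic_abs \<theta> * padic_abs \<theta>"
      by (simp add: D_def padic_abs_mult power2_eq_square)
    also have "\<dots> < padic_abs \<theta>"
      using that theta(2) padic_abs_nonneg[of \<theta>] by (simp add: less_le)
    also have "\<dots> = padic_abs (4 * (- \<theta>))" by (simp add: padic_abs_mult abs_4)
    finally have "(\<exists>e. e\<^sup>2 = D) \<longleftrightarrow> (\<exists>e. e\<^sup>2 = 4 * (- \<theta>))"
      by (rule padic_square_perturb[OF p3])
    also have "\<dots> \<longleftrightarrow> (\<exists>e. e\<^sup>2 = - \<theta>)" by (rule square_4_mult)
    also have "\<dots> \<longleftrightarrow> even (padic_ord (- \<theta>)) \<and> Legendre (- int (d 0)) (int CARD('p)) = 1"
    proof (rule padic_square_iff[OF p3])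
      have "padic_unit_part (- \<theta>) - of_int (- int (d 0)) = - (padic_unit_part \<theta> - of_nat (d 0))"
        by (simp add: padic_unit_part_minus)
      thus "padic_abs (padic_unit_part (- \<theta>) - of_int (- int (d 0))) < 1"
        using d by (simp only: padic_abs_minus)
    qed (use theta in simp)
    finally show ?thesis by (simp add: padic_ord_minus p(1))
  qed

  \<comment> \<open>An element of order 0 is its own unit part.\<close>
  have near: "padic_abs (\<theta> - of_nat (d 0)) < 1" if "padic_abs \<theta> = 1"
  proof -
    have "padic_ord \<theta> = 0" using that by (intro padic_ord_eqI) simp
    thus ?thesis using d by (simp add: padic_unit_part_def)
  qed

  have generic: "(\<exists>e. e\<^sup>2 = D) \<longleftrightarrow> Legendre (int (d 0) ^ 2 - 4 * int (d 0)) (int p) = 1"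
    if "padic_abs \<theta> = 1" and nd: "\<not> int p dvd int (d 0) ^ 2 - 4 * int (d 0)"
  proof -
    define a where "a = int (d 0) ^ 2 - 4 * int (d 0)"
    have "padic_abs (of_int a :: 'p padic) = 1"
      using nd padic_abs_of_int_less_1_iff[of a, where 'p = 'p]
        padic_abs_of_int_le_1[of a, where 'p = 'p] by (simp add: a_def p(1))
    moreover have "padic_abs (D - of_int a) < 1"
    proof -
      \<comment> \<open>The first factor has absolute value below 1, the second at most 1.\<close>
      have "D - of_int a = (\<theta> - of_nat (d 0)) * (\<theta> + of_int (int (d 0) - 4))"
        by (simp add: D_def a_def power2_eq_square algebra_simps)
      moreover have "padic_abs (\<theta> + of_int (int (d 0) - 4)) \<le> 1"
        using that(1) padic_abs_ultra[of \<theta> "of_int (int (d 0) - 4)"]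
          padic_abs_of_int_le_1[of "int (d 0) - 4", where 'p = 'p] by simp
      ultimately show ?thesis
        using near[OF that(1)]
        by (metis le_less_trans mult_right_le_one_le padic_abs_mult padic_abs_nonneg)
    qed
    ultimately have "(\<exists>e. e\<^sup>2 = D) \<longleftrightarrow> (\<exists>e :: 'p padic. e\<^sup>2 = of_int a)"
      by (intro padic_square_perturb[OF p3]) simp
    also have "\<dots> \<longleftrightarrow> QuadRes (int CARD('p)) a"
      using nd by (intro padic_square_of_int_iff[OF p3]) (simp add: a_def p(1))
    also have "\<dots> \<longleftrightarrow> Legendre a (int p) = 1"
      using nd by (simp add: Legendre_def cong_0_iff a_def p(1))
    finally show ?thesis by (simp add: a_def)
  qed

  \<comment> \<open>The digit d 0 is prime to p, so p divides d 0 - 4 and \<open>\<theta>\<close> is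
    close to 4. Then D = 4 (\<open>\<theta>\<close> - 4) + (\<open>\<theta>\<close> - 4)^2, where
    the second summand is negligible.\<close>
  have critical: "(\<exists>e. e\<^sup>2 = D) \<longleftrightarrow> even (padic_ord (\<theta> - 4)) \<and>
      Legendre (int (padic_residue (padic_unit_part (\<theta> - 4)))) (int p) = 1"
    if "padic_abs \<theta> = 1" and dv: "int p dvd int (d 0) ^ 2 - 4 * int (d 0)"
  proof -
    have nz: "\<theta> - 4 \<noteq> 0" using theta by simp
    have "int p dvd int (d 0) * (int (d 0) - 4)"
      using dv by (simp add: power2_eq_square algebra_simps)
    moreover have "\<not> int p dvd int (d 0)"
      using digits by (auto simp: padic_expansion_def p(1) dest: nat_dvd_not_less)
    ultimately have "int CARD('p) dvd int (d 0) - 4"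
      using prime_card_int[where 'a = 'p] prime_dvd_mult_iff p(1) by blast
    hence "padic_abs (of_int (int (d 0) - 4) :: 'p padic) < 1"
      by (simp only: padic_abs_of_int_less_1_iff)
    hence lt: "padic_abs (\<theta> - 4) < 1"
      using near[OF that(1)] padic_abs_ultra[of "\<theta> - of_nat (d 0)" "of_int (int (d 0) - 4)"]
      by simp
    have "D - 4 * (\<theta> - 4) = (\<theta> - 4) * (\<theta> - 4)"
      by (simp add: D_def power2_eq_square algebra_simps)
    hence "padic_abs (D - 4 * (\<theta> - 4)) = padic_abs (\<theta> - 4) * padic_abs (\<theta> - 4)"
      by (simp only: padic_abs_mult)
    also have "\<dots> < padic_abs (\<theta> - 4)"
      using lt nz padic_abs_nonneg[of "\<theta> - 4"] by (simp add: less_le)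
    also have "\<dots> = padic_abs (4 * (\<theta> - 4))" by (simp only: padic_abs_mult abs_4 mult_1)
    finally have "(\<exists>e. e\<^sup>2 = D) \<longleftrightarrow> (\<exists>e. e\<^sup>2 = 4 * (\<theta> - 4))"
      by (rule padic_square_perturb[OF p3])
    also have "\<dots> \<longleftrightarrow> (\<exists>e. e\<^sup>2 = \<theta> - 4)" by (rule square_4_mult)
    also have "\<dots> \<longleftrightarrow> even (padic_ord (\<theta> - 4)) \<and>
        Legendre (int (padic_residue (padic_unit_part (\<theta> - 4)))) (int CARD('p)) = 1"
      using padic_residue(2)[of "padic_unit_part (\<theta> - 4)"] padic_abs_unit_part[OF nz]
      by (intro padic_square_iff[OF p3 nz]) simp
    finally show ?thesis by (simp add: p(1))
  qed

  \<comment> \<open>The Legendre symbol takes the value 0 at multiples of p, so the values 1 and -1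
    already place \<open>\<theta>\<close> in the generic case.\<close>
  have not_dvd: "\<not> int p dvd a" if "Legendre a (int p) \<noteq> 0" for a
    using that by (auto simp: Legendre_def cong_0_iff)
  have generic_Legendre: "(\<exists>e. e\<^sup>2 = D) \<longleftrightarrow> Legendre (int (d 0) ^ 2 - 4 * int (d 0)) (int p) = 1"
    if "padic_abs \<theta> = 1" "Legendre (int (d 0) ^ 2 - 4 * int (d 0)) (int p) \<noteq> 0"
    using generic[OF that(1) not_dvd[OF that(2)]] .
  have two: "N_PGpGM 2 lam = 2" if "\<exists>e. e\<^sup>2 = D"
    using that by (simp only: N if_True)
  have zero: "N_PGpGM 2 lam = 0" if "\<not> (\<exists>e. e\<^sup>2 = D)"
    using that by (simp only: N if_False)
  show ?thesis
  proof (intro conjI impI)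
    assume *: "padic_abs \<theta> < 1 \<and> (odd (padic_ord \<theta>) \<or> Legendre (- int (d 0)) (int p) = -1)"
    show "N_PGpGM 2 lam = 0" by (rule zero, subst small) (use * in auto)
  next
    assume *: "padic_abs \<theta> = 1 \<and> Legendre (int (d 0) ^ 2 - 4 * int (d 0)) (int p) = -1"
    show "N_PGpGM 2 lam = 0" by (rule zero, subst generic_Legendre) (use * in auto)
  next
    assume *: "padic_abs \<theta> = 1 \<and> int p dvd int (d 0) ^ 2 - 4 * int (d 0) \<and>
      (odd (padic_ord (\<theta> - 4)) \<or>
       Legendre (int (padic_residue (padic_unit_part (\<theta> - 4)))) (int p) = -1)"
    show "N_PGpGM 2 lam = 0" by (rule zero, subst critical) (use * in auto)
  next
    assume "padic_abs \<theta> > 1"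
    thus "N_PGpGM 2 lam = 2" by (intro two large)
  next
    assume *: "padic_abs \<theta> < 1 \<and> even (padic_ord \<theta>) \<and> Legendre (- int (d 0)) (int p) = 1"
    show "N_PGpGM 2 lam = 2" by (rule two, subst small) (use * in auto)
  next
    assume *: "padic_abs \<theta> = 1 \<and> Legendre (int (d 0) ^ 2 - 4 * int (d 0)) (int p) = 1"
    show "N_PGpGM 2 lam = 2" by (rule two, subst generic_Legendre) (use * in auto)
  next
    assume *: "padic_abs \<theta> = 1 \<and> int p dvd int (d 0) ^ 2 - 4 * int (d 0) \<and>
      even (padic_ord (\<theta> - 4)) \<and>
      Legendre (int (padic_residue (padic_unit_part (\<theta> - 4)))) (int p) = 1"
    show "N_PGpGM 2 lam = 2" by (rule two, subst critical) (use * in auto)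
  qed
qed

end
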